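(* Let $\mathbb{A}\in\mathbb{M}_{d,d'}$ be partitioned into three blocks $A,B,C$. Then there exist isometries $U,V,W$ of suitable sizes such that $$\sqrt{3}\,|\mathbb{A}|\ \ge\ U|A|U^*+V|B|V^*+W|C|W^*.$$ The constant $\sqrt3$ is the best one: for $$\mathbb{A}=\begin{bmatrix} x&y&z\\ x&y&z\\ x&y&z\end{bmatrix},\qquad (x,y,z)\neq(0,0,0),$$ partitioned into its three lines (rows) $A,B,C$, and any real $c<\sqrt3$, there are no isometries $U,V,W$ with $c\,|\mathbb{A}|\ge U|A|U^*+V|B|V^*+W|C|W^*$. Similarly, if $\mathbb{A}\in\mathbb{M}_{d,d'}$ is partitioned into two blocks $A,B$, then there exist isometries $U,V$ of suitable sizes such that $\sqrt2\,|\mathbb{A}|\ge U|A|U^*+V|B|V^*$, and the constant $\sqrt2$ cannot be replaced by a smaller one valid for all such $\mathbb{A}$.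
   Context: $\mathbb{M}_{n,m}$ is the space of complex $n\times m$ matrices. For $S\in\mathbb{M}_{n,m}$, $|S|=(S^*S)^{1/2}\in\mathbb{M}_m$ is its absolute value. A matrix $U\in\mathbb{M}_{n,m}$ with $m\le n$ is an isometry if $U^*U$ is the identity of $\mathbb{M}_m$; "suitable sizes" means that the isometry attached to a block with $m$ columns belongs to $\mathbb{M}_{d',m}$. The relation $\ge$ between Hermitian matrices is the Loewner order. A partitioning of $\mathbb{A}$ into blocks is any decomposition of the rectangular array of entries of $\mathbb{A}$ into pairwise disjoint nonempty rectangular blocks (submatrices formed by consecutive rows and consecutive columns) covering all entries. *)

theory Defs
  imports
    Complex_Main
    "HOL-Library.Disjoint_Sets"
    "Jordan_Normal_Form.Schur_Decomposition"
    "Jordan_Normal_Form.DL_Submatrix"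
begin

definition hermitian :: "complex mat \<Rightarrow> bool" where
  "hermitian A \<longleftrightarrow> mat_adjoint A = A"

(* The order on complex makes 0 \<le> z mean that z is real and nonnegative. *)
definition psd :: "complex mat \<Rightarrow> bool" where
  "psd A \<longleftrightarrow> square_mat A \<and> hermitian A \<and>
     (\<forall>v \<in> carrier_vec (dim_row A). 0 \<le> (A *\<^sub>v v) \<bullet>c v)"

definition loewner_ge :: "complex mat \<Rightarrow> complex mat \<Rightarrow> bool"  (infix \<open>\<ge>\<^sub>L\<close> 50) where
  "A \<ge>\<^sub>L B \<longleftrightarrow> dim_row A = dim_row B \<and> dim_col A = dim_col B \<and>
     hermitian A \<and> hermitian B \<and> psd (A - B)"

(* The positive semidefinite square root; it is meant for positive semidefinite arguments,
   where it exists and is unique. *)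
definition psd_sqrt :: "complex mat \<Rightarrow> complex mat" where
  "psd_sqrt P = (THE R. psd R \<and> R * R = P)"

definition mat_abs :: "complex mat \<Rightarrow> complex mat" where
  "mat_abs S = psd_sqrt (mat_adjoint S * S)"

definition isometry :: "nat \<Rightarrow> nat \<Rightarrow> complex mat \<Rightarrow> bool" where
  "isometry n m U \<longleftrightarrow> U \<in> carrier_mat n m \<and> m \<le> n \<and> mat_adjoint U * U = 1\<^sub>m m"

(* A rectangle I \<times> J is given by its row indices I and column indices J.
   partition_on excludes empty rectangles; the distinctness makes the list enumerate the
   members of the partition without repetition, so that its length is the number of blocks. *)
definition rect_partition :: "nat \<Rightarrow> nat \<Rightarrow> (nat set \<times> nat set) list \<Rightarrow> bool" where
  "rect_partition n m Rs \<longleftrightarrow>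
     (\<forall>(I, J) \<in> set Rs. \<exists>r r' c c'. I = {r..<r'} \<and> J = {c..<c'}) \<and>
     distinct (map (\<lambda>(I, J). I \<times> J) Rs) \<and>
     partition_on ({..<n} \<times> {..<m}) (set (map (\<lambda>(I, J). I \<times> J) Rs))"

definition partitioned_into :: "complex mat \<Rightarrow> complex mat list \<Rightarrow> bool" where
  "partitioned_into M Bs \<longleftrightarrow>
     (\<exists>Rs. rect_partition (dim_row M) (dim_col M) Rs \<and>
           Bs = map (\<lambda>(I, J). submatrix M I J) Rs)"

end

theory Submission
  imports Defs "Jordan_Normal_Form.Spectral_Radius"
begin

text \<open>
  Write \<open>|S|\<^sup>2 = S\<^sup>* S\<close>. Both inequalities rest on a Pythagorean identity: if \<open>M\<close> is
  partitioned into two or three blocks \<open>A\<^sub>k\<close>, there are isometries \<open>U\<^sub>k\<close> with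
  \<open>|M|\<^sup>2 = \<Sum>\<^sub>k U\<^sub>k |A\<^sub>k|\<^sup>2 U\<^sub>k\<^sup>*\<close> (\<open>gram_two_blocks\<close>, \<open>gram_three_blocks\<close>).
  With \<open>X\<^sub>k = U\<^sub>k |A\<^sub>k| U\<^sub>k\<^sup>*\<close> the right-hand side is \<open>\<Sum>\<^sub>k X\<^sub>k\<^sup>2\<close>, and for \<open>m\<close> blocks
  \<open>(\<Sum>\<^sub>k X\<^sub>k)\<^sup>2 \<le> m \<Sum>\<^sub>k X\<^sub>k\<^sup>2 = (\<surd>m |M|)\<^sup>2\<close> by the Cauchy-Schwarz inequality. Since the square root is
  operator monotone (\<open>psd_diff_if_norm_le\<close>), \<open>\<Sum>\<^sub>k X\<^sub>k \<le> \<surd>m |M|\<close>.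

  The identity is obtained one cut at a time. For a horizontal cut, \<open>M\<^sup>* M\<close> is the sum of the Gram
  matrices of the two parts. For a vertical cut, let \<open>P = |M|\<close> and let \<open>E\<^sub>1\<close>, \<open>E\<^sub>2\<close> be the 0-1 matrices
  that select the columns of the two parts, so that \<open>A\<^sub>k = M E\<^sub>k\<close> and
  \<open>E\<^sub>1 E\<^sub>1\<^sup>* + E\<^sub>2 E\<^sub>2\<^sup>* = 1\<close>. Then \<open>P\<^sup>2 = \<Sum>\<^sub>k (P E\<^sub>k) (P E\<^sub>k)\<^sup>*\<close> and
  \<open>(P E\<^sub>k)\<^sup>* (P E\<^sub>k) = |A\<^sub>k|\<^sup>2\<close>, and an isometry exchanges the two products
  (\<open>adjoint_product_congruence\<close>). Every partition into two or three rectangles comes from such cuts: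
  one of three rectangles has a full side (\<open>three_rectangles_full_side\<close>), and removing it leaves a
  rectangle.

  For optimality, a matrix with \<open>m\<close> equal nonzero rows \<open>A\<close> has \<open>|M| = \<surd>m |A|\<close>. Taking traces in
  \<open>c |M| \<ge> \<Sum>\<^sub>k U\<^sub>k |A| U\<^sub>k\<^sup>*\<close> leaves \<open>c \<surd>m \<ge> m\<close> (\<open>repeated_row_bound\<close>).

  Positive square roots, their uniqueness and their monotonicity are derived from an orthonormal
  eigenbasis of a Hermitian matrix (\<open>hermitian_eigenbasis\<close>).
\<close>

section \<open>Adjoints and the inner product\<close>

lemma dim_mat_adjoint [simp]:
  "dim_row (mat_adjoint A) = dim_col A" "dim_col (mat_adjoint A) = dim_row A"
  by (simp_all add: mat_adjoint_def)

lemma mat_adjoint_carrier [simp]: "A \<in> carrier_mat n m \<Longrightarrow> mat_adjoint A \<in> carrier_mat m n"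
  by (intro carrier_matI) auto

lemma mat_adjoint_index [simp]:
  fixes A :: "complex mat"
  assumes "i < dim_col A" "j < dim_row A"
  shows "mat_adjoint A $$ (i, j) = cnj (A $$ (j, i))"
  using assms by (simp add: mat_adjoint_def mat_of_rows_index)

lemma mat_adjoint_adjoint [simp]:
  fixes A :: "complex mat"
  shows "mat_adjoint (mat_adjoint A) = A"
  by (rule eq_matI) auto

lemma mat_mult_index_sum:
  fixes A B :: "complex mat"
  assumes "A \<in> carrier_mat n m" "B \<in> carrier_mat m k" "i < n" "j < k"
  shows "(A * B) $$ (i, j) = (\<Sum>l<m. A $$ (i, l) * B $$ (l, j))"
proof -
  have d: "dim_row A = n" "dim_col A = m" "dim_row B = m" "dim_col B = k" using assms by auto
  show ?thesis using assms(3,4)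
    by (simp add: scalar_prod_def d lessThan_atLeast0)
qed

lemma mat_adjoint_mult:
  fixes A B :: "complex mat"
  assumes A: "A \<in> carrier_mat n m" and B: "B \<in> carrier_mat m k"
  shows "mat_adjoint (A * B) = mat_adjoint B * mat_adjoint A"
proof (rule eq_matI)
  have d: "dim_row A = n" "dim_col A = m" "dim_row B = m" "dim_col B = k" using A B by auto
  fix i j assume "i < dim_row (mat_adjoint B * mat_adjoint A)" "j < dim_col (mat_adjoint B * mat_adjoint A)"
  hence ij: "i < k" "j < n" using d by simp_all
  have "mat_adjoint (A * B) $$ (i, j) = cnj ((A * B) $$ (j, i))"
    by (rule mat_adjoint_index) (simp_all add: d ij)
  also have "(A * B) $$ (j, i) = (\<Sum>l<m. A $$ (j, l) * B $$ (l, i))"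
    by (rule mat_mult_index_sum[OF A B ij(2,1)])
  also have "cnj \<dots> = (\<Sum>l<m. mat_adjoint B $$ (i, l) * mat_adjoint A $$ (l, j))"
    unfolding cnj_sum by (intro sum.cong refl) (simp add: d ij mult.commute)
  also have "\<dots> = (mat_adjoint B * mat_adjoint A) $$ (i, j)"
    by (rule mat_mult_index_sum[symmetric, OF mat_adjoint_carrier[OF B] mat_adjoint_carrier[OF A] ij])
  finally show "mat_adjoint (A * B) $$ (i, j) = (mat_adjoint B * mat_adjoint A) $$ (i, j)" .
qed simp_all

lemma mat_adjoint_add:
  fixes A B :: "complex mat"
  assumes "A \<in> carrier_mat n m" "B \<in> carrier_mat n m"
  shows "mat_adjoint (A + B) = mat_adjoint A + mat_adjoint B"
  using assms by (intro eq_matI) auto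

lemma mat_adjoint_minus:
  fixes A B :: "complex mat"
  assumes "A \<in> carrier_mat n m" "B \<in> carrier_mat n m"
  shows "mat_adjoint (A - B) = mat_adjoint A - mat_adjoint B"
  using assms by (intro eq_matI) auto

lemma mat_adjoint_smult:
  fixes A :: "complex mat"
  shows "mat_adjoint (c \<cdot>\<^sub>m A) = cnj c \<cdot>\<^sub>m mat_adjoint A"
  by (intro eq_matI) auto

lemma cscalar_prod_sum:
  fixes v w :: "complex vec"
  assumes "w \<in> carrier_vec n"
  shows "v \<bullet>c w = (\<Sum>i<n. v $ i * cnj (w $ i))"
  using assms by (auto simp: scalar_prod_def lessThan_atLeast0)

lemma mult_mat_vec_sum:
  fixes A :: "complex mat"
  assumes "A \<in> carrier_mat n m" "v \<in> carrier_vec m" "i < n"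
  shows "(A *\<^sub>v v) $ i = (\<Sum>l<m. A $$ (i, l) * v $ l)"
  using assms by (auto simp: scalar_prod_def lessThan_atLeast0)

lemma cscalar_prod_adjoint:
  fixes A :: "complex mat"
  assumes A: "A \<in> carrier_mat n m" and x: "x \<in> carrier_vec m" and y: "y \<in> carrier_vec n"
  shows "(A *\<^sub>v x) \<bullet>c y = x \<bullet>c (mat_adjoint A *\<^sub>v y)"
proof -
  have "(A *\<^sub>v x) \<bullet>c y = (\<Sum>i<n. (\<Sum>l<m. A $$ (i, l) * x $ l) * cnj (y $ i))"
    unfolding cscalar_prod_sum[OF y] using mult_mat_vec_sum[OF A x] by simp
  also have "\<dots> = (\<Sum>l<m. \<Sum>i<n. A $$ (i, l) * x $ l * cnj (y $ i))"
    unfolding sum_distrib_right by (rule sum.swap)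
  also have "\<dots> = (\<Sum>l<m. x $ l * cnj (\<Sum>i<n. mat_adjoint A $$ (l, i) * y $ i))"
    using A by (auto simp: sum_distrib_left mult_ac intro!: sum.cong)
  also have "\<dots> = (\<Sum>l<m. x $ l * cnj ((mat_adjoint A *\<^sub>v y) $ l))"
    by (intro sum.cong refl) (subst mult_mat_vec_sum[OF mat_adjoint_carrier[OF A] y], auto)
  also have "\<dots> = x \<bullet>c (mat_adjoint A *\<^sub>v y)"
    by (rule cscalar_prod_sum[symmetric]) (rule mult_mat_vec_carrier[OF mat_adjoint_carrier[OF A] y])
  finally show ?thesis .
qed

lemma cscalar_prod_cnj:
  fixes v w :: "complex vec"
  assumes "v \<in> carrier_vec n" "w \<in> carrier_vec n"
  shows "w \<bullet>c v = cnj (v \<bullet>c w)"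
  using assms by (simp add: cscalar_prod_sum[of _ n] mult.commute)

definition vec_normsq :: "complex vec \<Rightarrow> real" where
  "vec_normsq v = (\<Sum>i<dim_vec v. (cmod (v $ i))\<^sup>2)"

lemma cscalar_prod_self: "v \<bullet>c v = complex_of_real (vec_normsq v)"
  unfolding vec_normsq_def
  by (subst cscalar_prod_sum[of _ "dim_vec v"]) (auto simp: complex_norm_square simp del: of_real_power)

lemma vec_normsq_nonneg [simp]: "0 \<le> vec_normsq v"
  by (simp add: vec_normsq_def sum_nonneg)

lemma vec_normsq_eq_0_iff: "vec_normsq v = 0 \<longleftrightarrow> v = 0\<^sub>v (dim_vec v)"
proof
  assume "vec_normsq v = 0"
  thus "v = 0\<^sub>v (dim_vec v)"
    unfolding vec_normsq_def by (subst (asm) sum_nonneg_eq_0_iff) (auto intro!: eq_vecI)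
next
  assume "v = 0\<^sub>v (dim_vec v)"
  hence "v $ i = 0" if "i < dim_vec v" for i using that by (metis index_zero_vec(1))
  thus "vec_normsq v = 0" by (simp add: vec_normsq_def)
qed

section \<open>Orthonormal families and isometries\<close>

definition orthonormal_family :: "nat \<Rightarrow> 'i set \<Rightarrow> ('i \<Rightarrow> complex vec) \<Rightarrow> bool" where
  "orthonormal_family n S u \<longleftrightarrow> (\<forall>i\<in>S. u i \<in> carrier_vec n) \<and>
     (\<forall>i\<in>S. \<forall>j\<in>S. u i \<bullet>c u j = (if i = j then 1 else 0))"

lemma normalise_vec:
  fixes w :: "complex vec"
  assumes w: "w \<in> carrier_vec n" and w0: "w \<noteq> 0\<^sub>v n"
  obtains a :: complex where "(a \<cdot>\<^sub>v w) \<bullet>c (a \<cdot>\<^sub>v w) = 1" "a \<noteq> 0"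
proof -
  define s where "s = sqrt (vec_normsq w)"
  have "vec_normsq w \<noteq> 0" using w w0 by (auto simp: vec_normsq_eq_0_iff)
  hence s: "s \<noteq> 0" by (simp add: s_def)
  have "s * s = vec_normsq w" by (simp add: s_def)
  hence "complex_of_real s * complex_of_real s = w \<bullet>c w"
    by (metis cscalar_prod_self of_real_mult)
  moreover have "((1 / complex_of_real s) \<cdot>\<^sub>v w) \<bullet>c ((1 / complex_of_real s) \<cdot>\<^sub>v w)
      = (w \<bullet>c w) / (complex_of_real s * complex_of_real s)"
    using w by (simp add: cscalar_prod_sum[of _ n] sum_divide_distrib)
  ultimately show ?thesis using s by (intro that[of "1 / complex_of_real s"]) auto
qed

text \<open>
  A square matrix whose rows are the conjugated members of the family, padded with zero rows,
  is singular when the family has fewer than \<open>n\<close> members; a kernel vector is orthogonal to the family.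
\<close>

lemma unit_vec_orthogonal_to_family:
  assumes u: "orthonormal_family n S u" and fin: "finite S" and card: "card S < n"
  obtains w where "w \<in> carrier_vec n" "w \<bullet>c w = 1" "\<And>i. i \<in> S \<Longrightarrow> w \<bullet>c u i = 0"
proof -
  obtain h where h: "bij_betw h {..<card S} S"
    using ex_bij_betw_nat_finite[OF fin] by (auto simp: lessThan_atLeast0)
  define c where "c i = (if i < card S then conjugate (u (h i)) else 0\<^sub>v n)" for i
  define A where "A = mat\<^sub>r n n (\<lambda>i. if i = card S then 0\<^sub>v n else c i)"
  have c: "c i \<in> carrier_vec n" for i
  proof (cases "i < card S")
    case True
    hence "h i \<in> S" using h by (auto simp: bij_betw_def)
    thus ?thesis using True u by (simp add: c_def orthonormal_family_def)
  qed (simp add: c_def)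
  have A: "A \<in> carrier_mat n n" by (simp add: A_def)
  have "det A = 0" unfolding A_def by (rule det_row_0) (use card c in auto)
  then obtain w where w: "w \<in> carrier_vec n" "w \<noteq> 0\<^sub>v n" "A *\<^sub>v w = 0\<^sub>v n"
    using det_0_iff_vec_prod_zero[OF A] by auto
  have orth: "w \<bullet>c u i = 0" if "i \<in> S" for i
  proof -
    obtain k where k: "k < card S" "h k = i" using h \<open>i \<in> S\<close>
      unfolding bij_betw_def by (metis imageE lessThan_iff)
    have ui: "u i \<in> carrier_vec n" using u that by (auto simp: orthonormal_family_def)
    have "0 = (A *\<^sub>v w) $ k" using w k card by simp
    also have "\<dots> = conjugate (u i) \<bullet> w"
      using k card ui by (simp add: A_def c_def)
    also have "\<dots> = w \<bullet>c u i" by (rule comm_scalar_prod) (use ui w in auto)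
    finally show ?thesis by simp
  qed
  obtain a where a: "(a \<cdot>\<^sub>v w) \<bullet>c (a \<cdot>\<^sub>v w) = 1" using normalise_vec[OF w(1,2)] .
  show ?thesis
  proof (rule that[of "a \<cdot>\<^sub>v w"])
    fix i assume i: "i \<in> S"
    hence "u i \<in> carrier_vec n" using u by (auto simp: orthonormal_family_def)
    thus "(a \<cdot>\<^sub>v w) \<bullet>c u i = 0" using orth[OF i] w(1) by simp
  qed (use w a in auto)
qed

lemma orthonormal_family_insert:
  assumes u: "orthonormal_family n S u" and t: "t \<notin> S"
    and w: "w \<in> carrier_vec n" "w \<bullet>c w = 1" "\<And>i. i \<in> S \<Longrightarrow> w \<bullet>c u i = 0"
  shows "orthonormal_family n (insert t S) (u(t := w))"
proof -
  have "u i \<bullet>c w = 0" if "i \<in> S" for i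
    using cscalar_prod_cnj[of w n "u i"] u w that by (auto simp: orthonormal_family_def)
  thus ?thesis using u t w unfolding orthonormal_family_def by auto
qed

text \<open>
  The index set need not be an initial segment: below, the family consists of the normalised
  images of the eigenvectors with nonzero eigenvalue, whose indices may lie anywhere, and the
  extension must keep each of these vectors at its index.
\<close>

lemma orthonormal_family_extend:
  assumes "finite T" "card (S \<union> T) \<le> n" "finite S" "orthonormal_family n S u"
  obtains u' where "orthonormal_family n (S \<union> T) u'" "\<And>i. i \<in> S \<Longrightarrow> u' i = u i"
  using assms
proof (induction T arbitrary: thesis rule: finite_induct)
  case empty
  thus ?case by auto
next
  case (insert t T)
  have "card (S \<union> T) \<le> card (S \<union> insert t T)"
    using insert by (intro card_mono) auto
  then obtain u' where u': "orthonormal_family n (S \<union> T) u'" "\<And>i. i \<in> S \<Longrightarrow> u' i = u i"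
    using insert by (metis le_trans)
  show ?case
  proof (cases "t \<in> S")
    case True
    thus ?thesis using u' insert.prems(1) by (metis Un_insert_right insert_absorb UnI1)
  next
    case False
    have t: "t \<notin> S \<union> T" using False insert by auto
    hence "card (S \<union> T) < n" using insert by auto
    then obtain w where w: "w \<in> carrier_vec n" "w \<bullet>c w = 1" "\<And>i. i \<in> S \<union> T \<Longrightarrow> w \<bullet>c u' i = 0"
      using unit_vec_orthogonal_to_family[OF u'(1)] insert by (metis finite_UnI)
    show ?thesis
    proof (rule insert.prems(1)[of "u'(t := w)"])
      show "orthonormal_family n (S \<union> insert t T) (u'(t := w))"
        using orthonormal_family_insert[OF u'(1) t w] by simp
    qed (use u'(2) False in auto)
  qed
qed

lemma isometry_of_family:
  assumes "orthonormal_family n {..<m} u" "m \<le> n"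
  shows "isometry n m (mat n m (\<lambda>(i, j). u j $ i))"
proof -
  let ?U = "mat n m (\<lambda>(i, j). u j $ i)"
  have "mat_adjoint ?U * ?U = 1\<^sub>m m"
  proof (rule eq_matI)
    fix i j assume "i < dim_row (1\<^sub>m m :: complex mat)" "j < dim_col (1\<^sub>m m :: complex mat)"
    hence ij: "i < m" "j < m" by auto
    have "(mat_adjoint ?U * ?U) $$ (i, j) = (\<Sum>l<n. mat_adjoint ?U $$ (i, l) * ?U $$ (l, j))"
      by (rule mat_mult_index_sum[of _ m n _ m]) (use ij in auto)
    also have "\<dots> = (\<Sum>l<n. u j $ l * cnj (u i $ l))"
      using ij by (intro sum.cong) (auto simp: mult.commute)
    also have "\<dots> = u j \<bullet>c u i"
      using ij assms by (subst cscalar_prod_sum[of _ n]) (auto simp: orthonormal_family_def)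
    finally show "(mat_adjoint ?U * ?U) $$ (i, j) = (1\<^sub>m m :: complex mat) $$ (i, j)"
      using ij assms by (auto simp: orthonormal_family_def)
  qed auto
  thus ?thesis using assms by (auto simp: isometry_def)
qed

lemma isometry_square:
  assumes "isometry n n U"
  shows "U * mat_adjoint U = 1\<^sub>m n"
  by (rule mat_mult_left_right_inverse[of "mat_adjoint U"]) (use assms in \<open>auto simp: isometry_def\<close>)

lemma adjoint_family_index:
  fixes y :: "complex vec"
  assumes u: "u i \<in> carrier_vec n" and i: "i < m" and y: "y \<in> carrier_vec n"
  shows "(mat_adjoint (mat n m (\<lambda>(i, j). u j $ i)) *\<^sub>v y) $ i = y \<bullet>c u i"
proof -
  let ?U = "mat n m (\<lambda>(i, j). u j $ i)"
  have "(mat_adjoint ?U *\<^sub>v y) $ i = (\<Sum>l<n. mat_adjoint ?U $$ (i, l) * y $ l)"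
    by (intro mult_mat_vec_sum[of _ m]) (use y i in auto)
  also have "\<dots> = y \<bullet>c u i"
    using i by (subst cscalar_prod_sum[OF u]) (auto simp: mult.commute intro!: sum.cong)
  finally show ?thesis .
qed

lemma orthogonal_to_basis_imp_zero:
  assumes u: "orthonormal_family n {..<n} u" and y: "y \<in> carrier_vec n"
    and orth: "\<And>i. i < n \<Longrightarrow> y \<bullet>c u i = 0"
  shows "y = 0\<^sub>v n"
proof -
  let ?U = "mat n n (\<lambda>(i, j). u j $ i)"
  have iso: "isometry n n ?U" using isometry_of_family[OF u] by simp
  have "mat_adjoint ?U *\<^sub>v y = 0\<^sub>v n"
  proof (rule eq_vecI)
    fix i assume i: "i < dim_vec (0\<^sub>v n :: complex vec)"
    hence "(mat_adjoint ?U *\<^sub>v y) $ i = y \<bullet>c u i"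
      by (intro adjoint_family_index) (use y u in \<open>auto simp: orthonormal_family_def\<close>)
    thus "(mat_adjoint ?U *\<^sub>v y) $ i = (0\<^sub>v n :: complex vec) $ i" using i orth by simp
  qed simp
  hence "?U *\<^sub>v (mat_adjoint ?U *\<^sub>v y) = 0\<^sub>v n" by auto
  also have "?U *\<^sub>v (mat_adjoint ?U *\<^sub>v y) = (?U * mat_adjoint ?U) *\<^sub>v y"
    by (rule assoc_mult_mat_vec[symmetric, of _ n n _ n]) (use y in auto)
  finally show ?thesis using isometry_square[OF iso] y by simp
qed

section \<open>Eigenbases of Hermitian matrices\<close>

lemma cscalar_prod_isometry:
  assumes "isometry n m U" "v \<in> carrier_vec m" "w \<in> carrier_vec m"
  shows "(U *\<^sub>v v) \<bullet>c (U *\<^sub>v w) = v \<bullet>c w"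
proof -
  have U: "U \<in> carrier_mat n m" "mat_adjoint U * U = 1\<^sub>m m" using assms by (auto simp: isometry_def)
  have "(U *\<^sub>v v) \<bullet>c (U *\<^sub>v w) = v \<bullet>c (mat_adjoint U *\<^sub>v (U *\<^sub>v w))"
    by (rule cscalar_prod_adjoint[OF U(1) assms(2)]) (use U assms in auto)
  also have "mat_adjoint U *\<^sub>v (U *\<^sub>v w) = (mat_adjoint U * U) *\<^sub>v w"
    by (rule assoc_mult_mat_vec[symmetric, OF mat_adjoint_carrier[OF U(1)] U(1) assms(3)])
  finally show ?thesis using U assms by simp
qed

lemma hermitian_cscalar_prod:
  assumes "hermitian H" "H \<in> carrier_mat n n" "x \<in> carrier_vec n" "y \<in> carrier_vec n"
  shows "(H *\<^sub>v x) \<bullet>c y = x \<bullet>c (H *\<^sub>v y)"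
  using cscalar_prod_adjoint[OF assms(2-4)] assms(1) by (simp add: hermitian_def)

lemma hermitian_form_real:
  assumes "hermitian H" "H \<in> carrier_mat n n" "x \<in> carrier_vec n"
  shows "Im ((H *\<^sub>v x) \<bullet>c x) = 0"
proof -
  have "(H *\<^sub>v x) \<bullet>c x = cnj ((H *\<^sub>v x) \<bullet>c x)"
    using hermitian_cscalar_prod[OF assms assms(3)] cscalar_prod_cnj[of "H *\<^sub>v x" n x] assms by auto
  thus ?thesis by (metis Reals_cnj_iff complex_is_Real_iff)
qed

lemma hermitian_adjoint_congruence:
  assumes H: "hermitian H" "H \<in> carrier_mat m m" and U: "U \<in> carrier_mat n m"
  shows "hermitian (U * H * mat_adjoint U)"
proof -
  have "mat_adjoint (U * H * mat_adjoint U) = U * (mat_adjoint H * mat_adjoint U)"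
    using H U by (subst mat_adjoint_mult[of _ n m _ n]) (auto simp: mat_adjoint_mult[of _ n m _ m])
  thus ?thesis using H U by (simp add: hermitian_def assoc_mult_mat[of _ n m _ m _ n])
qed

text \<open>
  Given orthonormal eigenvectors \<open>u\<close>, compress \<open>H\<close> to their orthogonal complement:
  if the columns of \<open>V\<close> form an orthonormal basis of the complement, then an eigenvector \<open>v\<close> of
  \<open>V\<^sup>* H V\<close> gives the eigenvector \<open>V v\<close> of \<open>H\<close>, because \<open>H\<close> maps the complement into itself.
\<close>

lemma hermitian_eigenvector_orthogonal:
  assumes H: "H \<in> carrier_mat n n" "hermitian H" and k: "k < n"
    and u: "orthonormal_family n {..<k} u"
    and eig: "\<And>i. i < k \<Longrightarrow> H *\<^sub>v u i = complex_of_real (l i) \<cdot>\<^sub>v u i"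
  obtains x :: "complex vec" and r :: real where "x \<in> carrier_vec n" "x \<bullet>c x = 1"
    "\<And>i. i < k \<Longrightarrow> x \<bullet>c u i = 0" "H *\<^sub>v x = complex_of_real r \<cdot>\<^sub>v x"
proof -
  have "{..<k} \<union> {..<n} = {..<n}" using k by auto
  then obtain u' where u': "orthonormal_family n {..<n} u'" "\<And>i. i < k \<Longrightarrow> u' i = u i"
    using orthonormal_family_extend[of "{..<n}" "{..<k}" n u] u by auto
  have u'c: "u' i \<in> carrier_vec n" if "i < n" for i using u' that by (auto simp: orthonormal_family_def)
  define m where "m = n - k"
  define V where "V = mat n m (\<lambda>(i, j). u' (k + j) $ i)"
  have "orthonormal_family n {..<m} (\<lambda>j. u' (k + j))"
    using u'(1) k by (auto simp: orthonormal_family_def m_def)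
  hence V: "isometry n m V"
    unfolding V_def by (rule isometry_of_family) (simp add: m_def)
  have Vc: "V \<in> carrier_mat n m" by (simp add: V_def)
  define H' where "H' = mat_adjoint V * (H * V)"
  have H': "H' \<in> carrier_mat m m" unfolding H'_def
    by (rule mult_carrier_mat[OF mat_adjoint_carrier[OF Vc] mult_carrier_mat[OF H(1) Vc]])
  have "m \<noteq> 0" using k by (simp add: m_def)
  then obtain \<mu> where "eigenvalue H' \<mu>" using spectrum_non_empty[OF H'] by (auto simp: spectrum_def)
  then obtain w where w: "w \<in> carrier_vec m" "w \<noteq> 0\<^sub>v m" "H' *\<^sub>v w = \<mu> \<cdot>\<^sub>v w"
    using H' by (auto simp: eigenvalue_def eigenvector_def)
  obtain a where a: "(a \<cdot>\<^sub>v w) \<bullet>c (a \<cdot>\<^sub>v w) = 1" using normalise_vec[OF w(1,2)] .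
  define v where "v = a \<cdot>\<^sub>v w"
  have v: "v \<in> carrier_vec m" "v \<bullet>c v = 1" using w a by (auto simp: v_def)
  have "H' *\<^sub>v v = a \<cdot>\<^sub>v (H' *\<^sub>v w)"
    unfolding v_def by (rule mult_mat_vec[OF H' w(1)])
  also have "\<dots> = \<mu> \<cdot>\<^sub>v v" by (simp add: w(3) v_def smult_smult_assoc mult.commute)
  finally have H'v: "H' *\<^sub>v v = \<mu> \<cdot>\<^sub>v v" .
  \<comment> \<open>The residual \<open>y\<close> below is orthogonal to \<open>u\<close> as \<open>H\<close> is Hermitian, and to the columns of \<open>V\<close> as \<open>v\<close> is an eigenvector of the compression; so it vanishes.\<close>
  define x where "x = V *\<^sub>v v"
  have x: "x \<in> carrier_vec n" using Vc v by (simp add: x_def)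
  have xx: "x \<bullet>c x = 1" using cscalar_prod_isometry[OF V v(1) v(1)] v by (simp add: x_def)
  have orth: "x \<bullet>c u i = 0" if i: "i < k" for i
  proof -
    have ui: "u i \<in> carrier_vec n" using u'c[of i] u'(2)[OF i] i k by simp
    have "mat_adjoint V *\<^sub>v u i = 0\<^sub>v m"
    proof (rule eq_vecI)
      fix j assume j: "j < dim_vec (0\<^sub>v m :: complex vec)"
      hence "(mat_adjoint V *\<^sub>v u i) $ j = u i \<bullet>c u' (k + j)"
        unfolding V_def by (intro adjoint_family_index ui u'c) (auto simp: m_def)
      also have "\<dots> = u' i \<bullet>c u' (k + j)" using u'(2)[OF i] by simp
      also have "\<dots> = 0" using u'(1) i j k by (auto simp: orthonormal_family_def m_def)
      finally show "(mat_adjoint V *\<^sub>v u i) $ j = (0\<^sub>v m :: complex vec) $ j" using j by simp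
    qed (use Vc in auto)
    thus ?thesis using cscalar_prod_adjoint[OF Vc v(1) ui] v(1) by (simp add: x_def)
  qed
  define y where "y = H *\<^sub>v x - \<mu> \<cdot>\<^sub>v x"
  have Hx: "H *\<^sub>v x \<in> carrier_vec n" using H x by simp
  have y: "y \<in> carrier_vec n" using Hx x by (simp add: y_def)
  have Vy: "mat_adjoint V *\<^sub>v y = 0\<^sub>v m"
  proof -
    have "mat_adjoint V *\<^sub>v (H *\<^sub>v x) = H' *\<^sub>v v"
      unfolding H'_def x_def using H Vc v
      by (simp add: assoc_mult_mat_vec[of _ m n _ m] assoc_mult_mat_vec[of _ n n _ m])
    moreover have "mat_adjoint V *\<^sub>v (\<mu> \<cdot>\<^sub>v x) = \<mu> \<cdot>\<^sub>v (mat_adjoint V *\<^sub>v x)"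
      using Vc x by (intro mult_mat_vec[of _ m n]) auto
    moreover have "mat_adjoint V *\<^sub>v x = v"
      using V v unfolding x_def isometry_def by (metis Vc assoc_mult_mat_vec mat_adjoint_carrier one_mult_mat_vec)
    ultimately show ?thesis
      unfolding y_def using H'v v Vc Hx x
      by (subst mult_minus_distrib_mat_vec[of _ m n]) auto
  qed
  have "y \<bullet>c u' i = 0" if i: "i < n" for i
  proof (cases "i < k")
    case True
    have ui: "u i \<in> carrier_vec n" using u'c[OF i] u'(2)[OF True] by simp
    have "(H *\<^sub>v x) \<bullet>c u i = x \<bullet>c (complex_of_real (l i) \<cdot>\<^sub>v u i)"
      using hermitian_cscalar_prod[OF H(2,1) x ui] eig[OF True] by simp
    also have "\<dots> = 0" using orth[OF True] ui x by (simp add: conjugate_smult_vec)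
    finally have "(H *\<^sub>v x) \<bullet>c u i = 0" .
    hence "y \<bullet>c u i = 0"
      unfolding y_def using orth[OF True] Hx x ui by (subst minus_scalar_prod_distrib[of _ n]) auto
    thus ?thesis using u'(2)[OF True] by simp
  next
    case False
    hence "(mat_adjoint V *\<^sub>v y) $ (i - k) = y \<bullet>c u' (k + (i - k))"
      unfolding V_def by (intro adjoint_family_index y u'c) (use i in \<open>auto simp: m_def\<close>)
    thus ?thesis using Vy False i by (simp add: m_def)
  qed
  hence y0: "y = 0\<^sub>v n" by (rule orthogonal_to_basis_imp_zero[OF u'(1) y])
  have Hx_eq: "H *\<^sub>v x = \<mu> \<cdot>\<^sub>v x"
  proof (rule eq_vecI)
    fix i assume "i < dim_vec (\<mu> \<cdot>\<^sub>v x)"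
    hence i: "i < n" using x by simp
    have "y $ i = (H *\<^sub>v x) $ i - (\<mu> \<cdot>\<^sub>v x) $ i"
      unfolding y_def by (rule index_minus_vec) (use i x in simp)
    thus "(H *\<^sub>v x) $ i = (\<mu> \<cdot>\<^sub>v x) $ i" using y0 i by simp
  qed (use x H in auto)
  have "Im \<mu> = 0"
    using hermitian_form_real[OF H(2,1) x] x xx by (simp add: Hx_eq)
  hence "\<mu> = complex_of_real (Re \<mu>)" by (simp add: complex_eq_iff)
  thus ?thesis using that[OF x xx orth] Hx_eq by metis
qed

lemma hermitian_eigenbasis:
  assumes H: "H \<in> carrier_mat n n" "hermitian H"
  obtains u :: "nat \<Rightarrow> complex vec" and l :: "nat \<Rightarrow> real" where "orthonormal_family n {..<n} u"
    "\<And>i. i < n \<Longrightarrow> H *\<^sub>v u i = complex_of_real (l i) \<cdot>\<^sub>v u i"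
proof -
  have "\<exists>u l. orthonormal_family n {..<k} u \<and>
      (\<forall>i<k. H *\<^sub>v u i = complex_of_real (l i) \<cdot>\<^sub>v u i)" if "k \<le> n" for k
    using that
  proof (induction k)
    case 0
    show ?case by (simp add: orthonormal_family_def)
  next
    case (Suc k)
    then obtain u l where u: "orthonormal_family n {..<k} u"
      "\<And>i. i < k \<Longrightarrow> H *\<^sub>v u i = complex_of_real (l i) \<cdot>\<^sub>v u i" by auto
    obtain x r where x: "x \<in> carrier_vec n" "x \<bullet>c x = 1" "\<And>i. i < k \<Longrightarrow> x \<bullet>c u i = 0"
      "H *\<^sub>v x = complex_of_real r \<cdot>\<^sub>v x"
      using hermitian_eigenvector_orthogonal[OF H _ u] Suc.prems by (metis Suc_le_lessD)
    have "orthonormal_family n (insert k {..<k}) (u(k := x))"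
      by (rule orthonormal_family_insert[OF u(1)]) (use x in auto)
    moreover have "\<forall>i<Suc k. H *\<^sub>v (u(k := x)) i = complex_of_real ((l(k := r)) i) \<cdot>\<^sub>v (u(k := x)) i"
      using u(2) x(4) by (auto simp: less_Suc_eq)
    ultimately show ?case by (metis lessThan_Suc)
  qed
  thus ?thesis using that by blast
qed

section \<open>Positive semidefinite matrices and their square roots\<close>

definition real_diag :: "nat \<Rightarrow> (nat \<Rightarrow> real) \<Rightarrow> complex mat" where
  "real_diag n l = mat n n (\<lambda>(i, j). if i = j then complex_of_real (l i) else 0)"

lemma real_diag_carrier [simp]: "real_diag n l \<in> carrier_mat n n"
  by (simp add: real_diag_def)

lemma hermitian_real_diag: "hermitian (real_diag n l)"
  unfolding hermitian_def real_diag_def by (rule eq_matI) auto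

lemma mult_real_diag_index:
  assumes "A \<in> carrier_mat m n" "i < m" "j < n"
  shows "(A * real_diag n l) $$ (i, j) = A $$ (i, j) * complex_of_real (l j)"
proof -
  have "(A * real_diag n l) $$ (i, j)
      = (\<Sum>k<n. if k = j then A $$ (i, j) * complex_of_real (l j) else 0)"
    unfolding mat_mult_index_sum[OF assms(1) real_diag_carrier assms(2,3)]
    using assms by (intro sum.cong) (auto simp: real_diag_def)
  thus ?thesis using assms by simp
qed

lemma real_diag_mult: "real_diag n l * real_diag n k = real_diag n (\<lambda>i. l i * k i)"
proof (rule eq_matI)
  fix i j assume "i < dim_row (real_diag n (\<lambda>i. l i * k i))" "j < dim_col (real_diag n (\<lambda>i. l i * k i))"
  hence ij: "i < n" "j < n" by (simp_all add: real_diag_def)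
  show "(real_diag n l * real_diag n k) $$ (i, j) = real_diag n (\<lambda>i. l i * k i) $$ (i, j)"
    unfolding mult_real_diag_index[OF real_diag_carrier ij] using ij by (simp add: real_diag_def)
qed (simp_all add: real_diag_def)

lemma real_diag_form:
  assumes "v \<in> carrier_vec n"
  shows "(real_diag n l *\<^sub>v v) \<bullet>c v = complex_of_real (\<Sum>i<n. l i * (cmod (v $ i))\<^sup>2)"
proof -
  have "(real_diag n l *\<^sub>v v) $ i = complex_of_real (l i) * v $ i" if i: "i < n" for i
  proof -
    have "(real_diag n l *\<^sub>v v) $ i = (\<Sum>k<n. if k = i then complex_of_real (l i) * v $ i else 0)"
      unfolding mult_mat_vec_sum[OF real_diag_carrier assms i]
      using i by (intro sum.cong) (auto simp: real_diag_def)
    thus ?thesis using i by simp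
  qed
  thus ?thesis
    by (simp add: cscalar_prod_sum[OF assms] complex_norm_square mult.assoc del: of_real_power)
qed

lemma hermitian_spectral_decomposition:
  assumes H: "H \<in> carrier_mat n n" "hermitian H"
  obtains Q :: "complex mat" and l :: "nat \<Rightarrow> real" where "isometry n n Q"
    "H = Q * real_diag n l * mat_adjoint Q"
    "\<And>i. i < n \<Longrightarrow> H *\<^sub>v col Q i = complex_of_real (l i) \<cdot>\<^sub>v col Q i"
proof -
  obtain u l where u: "orthonormal_family n {..<n} u"
    "\<And>i. i < n \<Longrightarrow> H *\<^sub>v u i = complex_of_real (l i) \<cdot>\<^sub>v u i"
    using hermitian_eigenbasis[OF H] by blast
  define Q where "Q = mat n n (\<lambda>(i, j). u j $ i)"
  have Q: "isometry n n Q" unfolding Q_def using isometry_of_family[OF u(1)] by simp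
  have Qc: "Q \<in> carrier_mat n n" by (simp add: Q_def)
  have colQ: "col Q j = u j" if "j < n" for j
  proof -
    have "dim_vec (u j) = n" using that u(1) by (auto simp: orthonormal_family_def)
    thus ?thesis using that by (intro eq_vecI) (simp_all add: Q_def)
  qed
  have HQ: "H * Q = Q * real_diag n l"
  proof (rule eq_matI)
    fix i j assume "i < dim_row (Q * real_diag n l)" "j < dim_col (Q * real_diag n l)"
    hence ij: "i < n" "j < n" using Qc by (auto simp: real_diag_def)
    have "(H * Q) $$ (i, j) = (H *\<^sub>v col Q j) $ i" using ij H Qc by simp
    also have "\<dots> = complex_of_real (l j) * Q $$ (i, j)"
    proof -
      have "dim_vec (u j) = n" using ij(2) u(1) by (auto simp: orthonormal_family_def)
      hence "(H *\<^sub>v col Q j) $ i = complex_of_real (l j) * u j $ i"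
        unfolding colQ[OF ij(2)] u(2)[OF ij(2)] using ij by simp
      thus ?thesis using ij by (simp add: Q_def)
    qed
    finally show "(H * Q) $$ (i, j) = (Q * real_diag n l) $$ (i, j)"
      using mult_real_diag_index[OF Qc ij] by simp
  qed (use H Qc in \<open>auto simp: real_diag_def\<close>)
  have "H = H * (Q * mat_adjoint Q)" using H isometry_square[OF Q] by simp
  also have "\<dots> = H * Q * mat_adjoint Q"
    by (rule assoc_mult_mat[symmetric, OF H(1) Qc mat_adjoint_carrier[OF Qc]])
  finally show ?thesis using that[OF Q] HQ u(2) colQ by simp
qed

lemma psd_iff:
  assumes "A \<in> carrier_mat n n"
  shows "psd A \<longleftrightarrow> hermitian A \<and> (\<forall>v\<in>carrier_vec n. 0 \<le> Re ((A *\<^sub>v v) \<bullet>c v))"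
  using assms hermitian_form_real[OF _ assms]
  by (auto simp: psd_def less_eq_complex_def)

lemma psd_form_nonneg:
  "psd A \<Longrightarrow> A \<in> carrier_mat n n \<Longrightarrow> v \<in> carrier_vec n \<Longrightarrow> 0 \<le> Re ((A *\<^sub>v v) \<bullet>c v)"
  by (simp add: psd_iff)

lemma psd_hermitian: "psd A \<Longrightarrow> hermitian A"
  by (simp add: psd_def)

lemma psd_congruence:
  assumes A: "psd A" "A \<in> carrier_mat m m" and U: "U \<in> carrier_mat n m"
  shows "psd (U * A * mat_adjoint U)"
proof -
  have c: "U * A * mat_adjoint U \<in> carrier_mat n n"
    by (rule mult_carrier_mat[OF mult_carrier_mat[OF U A(2)] mat_adjoint_carrier[OF U]])
  have "0 \<le> Re ((U * A * mat_adjoint U *\<^sub>v v) \<bullet>c v)" if v: "v \<in> carrier_vec n" for v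
  proof -
    let ?w = "mat_adjoint U *\<^sub>v v"
    have w: "?w \<in> carrier_vec m" by (rule mult_mat_vec_carrier[OF mat_adjoint_carrier[OF U] v])
    have "U * A * mat_adjoint U *\<^sub>v v = U *\<^sub>v (A *\<^sub>v ?w)"
      using A U v w
      by (simp add: assoc_mult_mat_vec[OF mult_carrier_mat[OF U A(2)] mat_adjoint_carrier[OF U] v]
          assoc_mult_mat_vec[OF U A(2) w])
    hence "(U * A * mat_adjoint U *\<^sub>v v) \<bullet>c v = (A *\<^sub>v ?w) \<bullet>c ?w"
      using cscalar_prod_adjoint[OF U mult_mat_vec_carrier[OF A(2) w] v] by simp
    thus ?thesis using psd_form_nonneg[OF A w] by simp
  qed
  thus ?thesis
    using hermitian_adjoint_congruence[OF psd_hermitian[OF A(1)] A(2) U] by (simp add: psd_iff[OF c])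
qed

lemma psd_real_diag:
  assumes "\<And>i. i < n \<Longrightarrow> 0 \<le> l i"
  shows "psd (real_diag n l)"
  unfolding psd_iff[OF real_diag_carrier]
  using assms by (auto simp: hermitian_real_diag real_diag_form intro!: sum_nonneg)

lemma congruence_mult:
  assumes U: "isometry n m U" and A: "A \<in> carrier_mat m m" and B: "B \<in> carrier_mat m m"
  shows "(U * A * mat_adjoint U) * (U * B * mat_adjoint U) = U * (A * B) * mat_adjoint U"
proof -
  have Uc: "U \<in> carrier_mat n m" "mat_adjoint U \<in> carrier_mat m n" "mat_adjoint U * U = 1\<^sub>m m"
    using U by (auto simp: isometry_def)
  have UB: "U * B \<in> carrier_mat n m" "U * B * mat_adjoint U \<in> carrier_mat n n"
    "B * mat_adjoint U \<in> carrier_mat m n" "U * A \<in> carrier_mat n m"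
    by (rule mult_carrier_mat[OF Uc(1) B] mult_carrier_mat[OF Uc(1) A] mult_carrier_mat[OF B Uc(2)]
        mult_carrier_mat[OF mult_carrier_mat[OF Uc(1) B] Uc(2)])+
  have "mat_adjoint U * (U * B * mat_adjoint U) = mat_adjoint U * U * B * mat_adjoint U"
    by (simp only: assoc_mult_mat[OF Uc(2) UB(1) Uc(2)] assoc_mult_mat[OF Uc(2) Uc(1) B])
  also have "\<dots> = B * mat_adjoint U" using Uc B by simp
  finally have *: "mat_adjoint U * (U * B * mat_adjoint U) = B * mat_adjoint U" .
  have "(U * A * mat_adjoint U) * (U * B * mat_adjoint U) = U * A * (B * mat_adjoint U)"
    using * by (simp add: assoc_mult_mat[OF UB(4) Uc(2) UB(2)])
  also have "\<dots> = U * (A * B) * mat_adjoint U"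
    by (simp only: assoc_mult_mat[OF Uc(1) A UB(3)] assoc_mult_mat[OF A B Uc(2)]
        assoc_mult_mat[OF Uc(1) mult_carrier_mat[OF A B] Uc(2)])
  finally show ?thesis .
qed

lemma psd_eigenvalue_nonneg:
  assumes A: "psd A" "A \<in> carrier_mat n n" and x: "x \<in> carrier_vec n" "x \<bullet>c x = 1"
    and eig: "A *\<^sub>v x = complex_of_real r \<cdot>\<^sub>v x"
  shows "0 \<le> r"
  using psd_form_nonneg[OF A x(1)] x by (simp add: eig)

lemma mult_mat_unit_vec:
  fixes A :: "complex mat"
  assumes "A \<in> carrier_mat n m" "i < m"
  shows "A *\<^sub>v unit_vec m i = col A i"
  using assms by (intro eq_vecI) auto

lemma isometry_col:
  assumes "isometry n m U" "i < m"
  shows "col U i \<in> carrier_vec n" "col U i \<bullet>c col U i = 1"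
proof -
  have U: "U \<in> carrier_mat n m" using assms by (simp add: isometry_def)
  thus c: "col U i \<in> carrier_vec n" by auto
  have "col U i = U *\<^sub>v unit_vec m i"
    by (rule mult_mat_unit_vec[OF U assms(2), symmetric])
  moreover have "unit_vec m i \<bullet>c (unit_vec m i :: complex vec) = 1"
    using assms(2) by (subst cscalar_prod_sum[of _ m]) (auto simp: unit_vec_def if_distrib cong: if_cong)
  ultimately show "col U i \<bullet>c col U i = 1"
    using cscalar_prod_isometry[OF assms(1), of "unit_vec m i" "unit_vec m i"] by simp
qed

lemma psd_if_eigenvalues_nonneg:
  assumes H: "H \<in> carrier_mat n n" "hermitian H"
    and ev: "\<And>x r. x \<in> carrier_vec n \<Longrightarrow> x \<bullet>c x = 1 \<Longrightarrow> H *\<^sub>v x = complex_of_real r \<cdot>\<^sub>v x \<Longrightarrow> 0 \<le> r"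
  shows "psd H"
proof -
  obtain Q l where Q: "isometry n n Q" "H = Q * real_diag n l * mat_adjoint Q"
    "\<And>i. i < n \<Longrightarrow> H *\<^sub>v col Q i = complex_of_real (l i) \<cdot>\<^sub>v col Q i"
    using hermitian_spectral_decomposition[OF H] by blast
  have "0 \<le> l i" if "i < n" for i using ev isometry_col[OF Q(1) that] Q(3)[OF that] by blast
  hence "psd (real_diag n l)" by (rule psd_real_diag)
  thus ?thesis using Q(1,2) psd_congruence[of "real_diag n l" n Q n] by (auto simp: isometry_def)
qed

text \<open>
  This is the operator monotonicity of the square root, since the hypothesis says
  \<open>S\<^sup>2 \<le> T\<^sup>2\<close>. Let \<open>x\<close> be a unit eigenvector of \<open>T - S\<close> with eigenvalue \<open>r\<close>, and put
  \<open>s = \<langle>S x, x\<rangle> \<ge> 0\<close>. Then \<open>\<langle>T x, x\<rangle> = s + r \<ge> 0\<close>, and expanding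
  \<open>\<parallel>T x\<parallel>\<^sup>2 = \<parallel>S x + r x\<parallel>\<^sup>2\<close> turns the hypothesis into \<open>0 \<le> r (2 s + r)\<close>.
  A negative \<open>r\<close> would force \<open>s + (s + r) \<le> 0\<close>, hence \<open>s = s + r = 0\<close> and \<open>r = 0\<close>.
\<close>

lemma psd_diff_if_norm_le:
  assumes S: "psd S" "S \<in> carrier_mat n n" and T: "psd T" "T \<in> carrier_mat n n"
    and le: "\<And>v. v \<in> carrier_vec n \<Longrightarrow> Re ((S *\<^sub>v v) \<bullet>c (S *\<^sub>v v)) \<le> Re ((T *\<^sub>v v) \<bullet>c (T *\<^sub>v v))"
  shows "psd (T - S)"
proof (rule psd_if_eigenvalues_nonneg)
  show "T - S \<in> carrier_mat n n" using S T by auto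
  show "hermitian (T - S)"
    using S T mat_adjoint_minus[of T n n S] by (auto simp: hermitian_def psd_def)
  fix x r assume x: "x \<in> carrier_vec n" "x \<bullet>c x = 1" and eig: "(T - S) *\<^sub>v x = complex_of_real r \<cdot>\<^sub>v x"
  let ?r = "complex_of_real r"
  have c: "T *\<^sub>v x \<in> carrier_vec n" "S *\<^sub>v x \<in> carrier_vec n" using S T x by auto
  have TSx: "T *\<^sub>v x - S *\<^sub>v x = ?r \<cdot>\<^sub>v x"
    using eig S T x by (simp add: minus_mult_distrib_mat_vec[of _ n n])
  have Tx: "T *\<^sub>v x = S *\<^sub>v x + ?r \<cdot>\<^sub>v x"
  proof (rule eq_vecI)
    fix i assume "i < dim_vec (S *\<^sub>v x + ?r \<cdot>\<^sub>v x)"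
    hence i: "i < n" using x by simp
    have "(T *\<^sub>v x - S *\<^sub>v x) $ i = (T *\<^sub>v x) $ i - (S *\<^sub>v x) $ i"
      by (rule index_minus_vec) (use S i in simp)
    moreover have "(S *\<^sub>v x + ?r \<cdot>\<^sub>v x) $ i = (S *\<^sub>v x) $ i + (?r \<cdot>\<^sub>v x) $ i"
      by (rule index_add_vec) (use x i in simp)
    ultimately show "(T *\<^sub>v x) $ i = (S *\<^sub>v x + ?r \<cdot>\<^sub>v x) $ i"
      using TSx by simp
  qed (use x T in simp)
  define s where "s = Re ((S *\<^sub>v x) \<bullet>c x)"
  have s: "(S *\<^sub>v x) \<bullet>c x = complex_of_real s"
    using hermitian_form_real[OF psd_hermitian[OF S(1)] S(2) x(1)] by (simp add: s_def complex_eq_iff)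
  have s': "x \<bullet>c (S *\<^sub>v x) = complex_of_real s"
    using hermitian_cscalar_prod[OF psd_hermitian[OF S(1)] S(2) x(1) x(1)] s by simp
  have "(T *\<^sub>v x) \<bullet>c x = complex_of_real (s + r)"
    unfolding Tx using c x s by (simp add: add_scalar_prod_distrib[of _ n])
  hence t: "0 \<le> s + r" using psd_form_nonneg[OF T x(1)] by simp
  have s0: "0 \<le> s" using psd_form_nonneg[OF S x(1)] by (simp add: s_def)
  have "(T *\<^sub>v x) \<bullet>c (T *\<^sub>v x) = (S *\<^sub>v x) \<bullet>c (S *\<^sub>v x) + complex_of_real (r * (2 * s + r))"
    unfolding Tx using c x s s'
    by (simp add: add_scalar_prod_distrib[of _ n] scalar_prod_add_distrib[of _ n]
        conjugate_add_vec[of _ n] conjugate_smult_vec algebra_simps)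
  hence "0 \<le> r * (2 * s + r)" using le[OF x(1)] by simp
  show "0 \<le> r"
  proof (rule ccontr)
    assume r: "\<not> 0 \<le> r"
    hence "2 * s + r \<le> 0" using \<open>0 \<le> r * (2 * s + r)\<close> by (simp add: zero_le_mult_iff)
    thus False using r s0 t by simp
  qed
qed

lemma psd_sqrt_exists:
  assumes P: "psd P" "P \<in> carrier_mat n n"
  obtains R where "psd R" "R \<in> carrier_mat n n" "R * R = P"
proof -
  obtain Q l where Q: "isometry n n Q" "P = Q * real_diag n l * mat_adjoint Q"
    "\<And>i. i < n \<Longrightarrow> P *\<^sub>v col Q i = complex_of_real (l i) \<cdot>\<^sub>v col Q i"
    using hermitian_spectral_decomposition[OF P(2) psd_hermitian[OF P(1)]] by blast
  have Qc: "Q \<in> carrier_mat n n" using Q by (simp add: isometry_def)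
  have l: "0 \<le> l i" if "i < n" for i
    using psd_eigenvalue_nonneg[OF P isometry_col[OF Q(1) that] Q(3)[OF that]] .
  let ?D = "real_diag n (\<lambda>i. sqrt (l i))"
  have "?D * ?D = real_diag n l"
    using l unfolding real_diag_mult by (intro eq_matI) (auto simp: real_diag_def)
  hence "(Q * ?D * mat_adjoint Q) * (Q * ?D * mat_adjoint Q) = P"
    using congruence_mult[OF Q(1) real_diag_carrier real_diag_carrier] Q(2) by simp
  moreover have "psd (Q * ?D * mat_adjoint Q)"
    by (intro psd_congruence[OF _ real_diag_carrier Qc] psd_real_diag) (use l in auto)
  moreover have "Q * ?D * mat_adjoint Q \<in> carrier_mat n n"
    by (rule mult_carrier_mat[OF mult_carrier_mat[OF Qc real_diag_carrier] mat_adjoint_carrier[OF Qc]])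
  ultimately show ?thesis using that by blast
qed

lemma mat_eq_0_if_all_mult_vec_0:
  fixes A :: "complex mat"
  assumes A: "A \<in> carrier_mat n m" and 0: "\<And>v. v \<in> carrier_vec m \<Longrightarrow> A *\<^sub>v v = 0\<^sub>v n"
  shows "A = 0\<^sub>m n m"
proof (rule eq_matI)
  fix i j assume "i < dim_row (0\<^sub>m n m :: complex mat)" "j < dim_col (0\<^sub>m n m :: complex mat)"
  hence ij: "i < n" "j < m" by auto
  have "col A j = A *\<^sub>v unit_vec m j" by (rule mult_mat_unit_vec[OF A ij(2), symmetric])
  hence "col A j $ i = 0" using 0[of "unit_vec m j"] ij by simp
  thus "A $$ (i, j) = (0\<^sub>m n m :: complex mat) $$ (i, j)" using A ij by simp
qed (use A in auto)

text \<open>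
  If \<open>H = K\<^sup>2\<close> with \<open>K\<close> Hermitian, then \<open>\<langle>H v, v\<rangle> = \<parallel>K v\<parallel>\<^sup>2\<close>, so the
  two signs together force \<open>K v = 0\<close>.
\<close>

lemma psd_antisym:
  assumes H: "psd H" "H \<in> carrier_mat n n" and neg: "\<And>v. v \<in> carrier_vec n \<Longrightarrow> Re ((H *\<^sub>v v) \<bullet>c v) \<le> 0"
  shows "H = 0\<^sub>m n n"
proof (rule mat_eq_0_if_all_mult_vec_0[OF H(2)])
  fix v :: "complex vec" assume v: "v \<in> carrier_vec n"
  obtain K where K: "psd K" "K \<in> carrier_mat n n" "K * K = H" using psd_sqrt_exists[OF H] .
  have Kv: "K *\<^sub>v v \<in> carrier_vec n" using K v by simp
  have Hv: "H *\<^sub>v v = K *\<^sub>v (K *\<^sub>v v)" using K v by (metis assoc_mult_mat_vec)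
  have "(K *\<^sub>v v) \<bullet>c (K *\<^sub>v v) = (H *\<^sub>v v) \<bullet>c v"
    using hermitian_cscalar_prod[OF psd_hermitian[OF K(1)] K(2) Kv v] Hv by simp
  hence "vec_normsq (K *\<^sub>v v) \<le> 0" using neg[OF v] cscalar_prod_self[of "K *\<^sub>v v"]
    by (metis Re_complex_of_real)
  hence "vec_normsq (K *\<^sub>v v) = 0" using vec_normsq_nonneg[of "K *\<^sub>v v"] by linarith
  hence "K *\<^sub>v v = 0\<^sub>v n" using Kv vec_normsq_eq_0_iff[of "K *\<^sub>v v"]
    by (metis carrier_vecD)
  thus "H *\<^sub>v v = 0\<^sub>v n" using Hv K by auto
qed

lemma psd_norm_square:
  assumes R: "psd R" "R \<in> carrier_mat n n" and v: "v \<in> carrier_vec n"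
  shows "(R *\<^sub>v v) \<bullet>c (R *\<^sub>v v) = ((R * R) *\<^sub>v v) \<bullet>c v"
  using hermitian_cscalar_prod[OF psd_hermitian[OF R(1)] R(2), of "R *\<^sub>v v" v] R v
  by (simp add: assoc_mult_mat_vec[of _ n n _ n])

text \<open>
  Two square roots of the same matrix satisfy \<open>\<parallel>R v\<parallel> = \<parallel>S v\<parallel>\<close> for all \<open>v\<close>, so
  monotonicity of the square root gives both \<open>R \<le> S\<close> and \<open>S \<le> R\<close>.
\<close>

lemma psd_sqrt_unique:
  assumes R: "psd R" "R \<in> carrier_mat n n" and S: "psd S" "S \<in> carrier_mat n n" and eq: "R * R = S * S"
  shows "R = S"
proof -
  have norm: "(R *\<^sub>v v) \<bullet>c (R *\<^sub>v v) = (S *\<^sub>v v) \<bullet>c (S *\<^sub>v v)" if "v \<in> carrier_vec n" for v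
    using psd_norm_square[OF R that] psd_norm_square[OF S that] eq by simp
  have RS: "psd (R - S)" by (rule psd_diff_if_norm_le[OF S R]) (simp add: norm)
  have SR: "psd (S - R)" by (rule psd_diff_if_norm_le[OF R S]) (simp add: norm)
  have c: "R - S \<in> carrier_mat n n" "S - R \<in> carrier_mat n n" using R S by auto
  have "R - S = 0\<^sub>m n n"
  proof (rule psd_antisym[OF RS c(1)])
    fix v :: "complex vec" assume v: "v \<in> carrier_vec n"
    have "((R - S) *\<^sub>v v) \<bullet>c v = - (((S - R) *\<^sub>v v) \<bullet>c v)"
      using R S v by (simp add: minus_mult_distrib_mat_vec[of _ n n] minus_scalar_prod_distrib[of _ n])
    thus "Re (((R - S) *\<^sub>v v) \<bullet>c v) \<le> 0" using psd_form_nonneg[OF SR c(2) v] by simp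
  qed
  show ?thesis
  proof (rule eq_matI)
    fix i j assume ij: "i < dim_row S" "j < dim_col S"
    hence "(R - S) $$ (i, j) = 0" using \<open>R - S = 0\<^sub>m n n\<close> S by simp
    thus "R $$ (i, j) = S $$ (i, j)" using ij R S by simp
  qed (use R S in auto)
qed

lemma gram_psd:
  assumes S: "S \<in> carrier_mat m n"
  shows "mat_adjoint S * S \<in> carrier_mat n n" "psd (mat_adjoint S * S)"
proof -
  show c: "mat_adjoint S * S \<in> carrier_mat n n"
    by (rule mult_carrier_mat[OF mat_adjoint_carrier[OF S] S])
  have "hermitian (mat_adjoint S * S)"
    unfolding hermitian_def mat_adjoint_mult[OF mat_adjoint_carrier[OF S] S] by simp
  moreover have "(mat_adjoint S * S *\<^sub>v v) \<bullet>c v = (S *\<^sub>v v) \<bullet>c (S *\<^sub>v v)" if v: "v \<in> carrier_vec n" for v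
    using cscalar_prod_adjoint[OF mat_adjoint_carrier[OF S] mult_mat_vec_carrier[OF S v] v]
    by (simp add: assoc_mult_mat_vec[OF mat_adjoint_carrier[OF S] S v])
  ultimately show "psd (mat_adjoint S * S)"
    by (auto simp: psd_iff[OF c] cscalar_prod_self)
qed

lemma psd_sqrt_eqI:
  assumes "psd R" "R \<in> carrier_mat n n"
  shows "psd_sqrt (R * R) = R"
  unfolding psd_sqrt_def
proof (rule the_equality)
  fix S assume S: "psd S \<and> S * S = R * R"
  have "dim_row S = n" "dim_col S = n"
    using S assms by (metis carrier_matD index_mult_mat(2,3))+
  hence "S \<in> carrier_mat n n" by auto
  thus "S = R" using psd_sqrt_unique S assms by metis
qed (use assms in simp)

lemma mat_abs:
  assumes "S \<in> carrier_mat m n"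
  shows "psd (mat_abs S)" "mat_abs S \<in> carrier_mat n n"
    "mat_abs S * mat_abs S = mat_adjoint S * S"
  using psd_sqrt_exists[OF gram_psd(2,1)[OF assms]] psd_sqrt_eqI unfolding mat_abs_def by metis+

section \<open>The products of a matrix with its adjoint\<close>

lemma isometry_mult:
  assumes U: "isometry n m U" and V: "isometry m k V"
  shows "isometry n k (U * V)"
proof -
  have c: "U \<in> carrier_mat n m" "V \<in> carrier_mat m k" "mat_adjoint U * U = 1\<^sub>m m"
    "mat_adjoint V * V = 1\<^sub>m k" "m \<le> n" "k \<le> m"
    using U V by (auto simp: isometry_def)
  note a = mat_adjoint_carrier[OF c(1)] mat_adjoint_carrier[OF c(2)]
  have "mat_adjoint (U * V) * (U * V) = mat_adjoint V * (mat_adjoint U * (U * V))"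
    unfolding mat_adjoint_mult[OF c(1,2)] by (rule assoc_mult_mat[OF a(2,1) mult_carrier_mat[OF c(1,2)]])
  also have "mat_adjoint U * (U * V) = V"
    using assoc_mult_mat[OF a(1) c(1,2)] c(2,3) by simp
  finally show ?thesis using c by (auto simp: isometry_def intro: mult_carrier_mat)
qed

lemma isometry_adjoint:
  assumes "isometry n n Q"
  shows "isometry n n (mat_adjoint Q)"
  using assms isometry_square[OF assms] by (auto simp: isometry_def)

lemma isometry_one: "isometry n n (1\<^sub>m n)"
proof -
  have "mat_adjoint (1\<^sub>m n) = (1\<^sub>m n :: complex mat)" by (rule eq_matI) auto
  thus ?thesis by (simp add: isometry_def)
qed

lemma congruence_congruence:
  fixes U V A :: "complex mat"
  assumes U: "U \<in> carrier_mat n m" and V: "V \<in> carrier_mat m k" and A: "A \<in> carrier_mat k k"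
  shows "U * (V * A * mat_adjoint V) * mat_adjoint U = (U * V) * A * mat_adjoint (U * V)"
proof -
  note c = mat_adjoint_carrier[OF U] mat_adjoint_carrier[OF V]
  note VA = mult_carrier_mat[OF V A]
  have "U * (V * A * mat_adjoint V) = U * V * A * mat_adjoint V"
    by (simp only: assoc_mult_mat[OF U VA c(2)] assoc_mult_mat[OF U V A])
  thus ?thesis
    unfolding mat_adjoint_mult[OF U V]
    by (simp only: assoc_mult_mat[OF mult_carrier_mat[OF mult_carrier_mat[OF U V] A] c(2,1)])
qed

text \<open>
  This is the content of the polar decomposition \<open>Y = U |Y|\<close> that is needed later. With
  \<open>Y\<^sup>* Y = Q D Q\<^sup>*\<close>, the columns of \<open>Z = Y Q\<close> are orthogonal with squared norms on the diagonal of
  \<open>D\<close>. Normalising the nonzero columns and filling in the others leads to an isometry \<open>V\<close> with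
  \<open>Z = V \<surd>D\<close>, and \<open>U = V Q\<^sup>*\<close>. The hypothesis \<open>n \<le> d\<close> leaves room for filling in.
\<close>

lemma adjoint_product_congruence:
  fixes Y :: "complex mat"
  assumes Y: "Y \<in> carrier_mat d n" and nd: "n \<le> d"
  obtains U where "isometry d n U" "Y * mat_adjoint Y = U * (mat_adjoint Y * Y) * mat_adjoint U"
proof -
  define G where "G = mat_adjoint Y * Y"
  have G: "G \<in> carrier_mat n n" "psd G" using gram_psd[OF Y] by (auto simp: G_def)
  obtain Q l where Q: "isometry n n Q" "G = Q * real_diag n l * mat_adjoint Q"
    "\<And>i. i < n \<Longrightarrow> G *\<^sub>v col Q i = complex_of_real (l i) \<cdot>\<^sub>v col Q i"
    using hermitian_spectral_decomposition[OF G(1) psd_hermitian[OF G(2)]] by blast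
  have l0: "0 \<le> l i" if "i < n" for i
    using psd_eigenvalue_nonneg[OF G(2,1) isometry_col[OF Q(1) that] Q(3)[OF that]] .
  have Qc: "Q \<in> carrier_mat n n" "mat_adjoint Q \<in> carrier_mat n n" "mat_adjoint Q * Q = 1\<^sub>m n"
    using Q by (auto simp: isometry_def)
  have D: "mat_adjoint Q * G * Q = real_diag n l"
    using congruence_congruence[OF Qc(2,1) real_diag_carrier, of l] Qc(3) isometry_one[of n]
    by (simp add: Q(2)[symmetric] isometry_def left_mult_one_mat[OF real_diag_carrier]
        right_mult_one_mat[OF real_diag_carrier])
  define Z where "Z = Y * Q"
  have Z: "Z \<in> carrier_mat d n" using Y Qc by (simp add: Z_def)
  have "mat_adjoint Z * Z = mat_adjoint Q * (mat_adjoint Y * (Y * Q))"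
    unfolding Z_def mat_adjoint_mult[OF Y Qc(1)]
    by (rule assoc_mult_mat[OF Qc(2) mat_adjoint_carrier[OF Y] mult_carrier_mat[OF Y Qc(1)]])
  also have "\<dots> = mat_adjoint Q * G * Q"
    unfolding G_def
    by (simp only: assoc_mult_mat[OF mat_adjoint_carrier[OF Y] Y Qc(1), symmetric]
        assoc_mult_mat[OF Qc(2) mult_carrier_mat[OF mat_adjoint_carrier[OF Y] Y] Qc(1)])
  finally have ZZ: "mat_adjoint Z * Z = real_diag n l" using D by simp
  have col_prod: "col Z j \<bullet>c col Z i = (if i = j then complex_of_real (l i) else 0)"
    if "i < n" "j < n" for i j
  proof -
    have "col Z j \<bullet>c col Z i = (\<Sum>k<d. Z $$ (k, j) * cnj (Z $$ (k, i)))"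
      using Z that by (subst cscalar_prod_sum[of _ d]) auto
    also have "\<dots> = (mat_adjoint Z * Z) $$ (i, j)"
      using Z that by (subst mat_mult_index_sum[of _ n d _ n])
        (auto simp: mult.commute intro!: sum.cong)
    finally show ?thesis using ZZ that by (simp add: real_diag_def)
  qed
  \<comment> \<open>Zero columns of \<open>Z\<close> cannot be normalised; their places are filled by extending the family.\<close>
  define S where "S = {i. i < n \<and> l i \<noteq> 0}"
  define u where "u i = complex_of_real (1 / sqrt (l i)) \<cdot>\<^sub>v col Z i" for i
  have "orthonormal_family d S u"
  proof -
    have colc: "col Z i \<in> carrier_vec d" for i using Z by (intro carrier_vecI) simp
    hence "u i \<in> carrier_vec d" for i by (simp add: u_def)
    moreover have "u j \<bullet>c u i = (if j = i then 1 else 0)" if "i \<in> S" "j \<in> S" for i j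
    proof -
      have ij: "i < n" "j < n" "l i \<noteq> 0" using that by (auto simp: S_def)
      have uu: "u j \<bullet>c u i = complex_of_real (1 / sqrt (l j) * (1 / sqrt (l i))) * (col Z j \<bullet>c col Z i)"
        unfolding u_def using colc[of i] colc[of j] by (simp add: conjugate_smult_vec)
      have one: "1 / sqrt (l i) * (1 / sqrt (l i)) * l i = 1"
        using l0[OF ij(1)] ij(3) by simp
      show ?thesis
      proof (cases "j = i")
        case True
        have "u j \<bullet>c u i = complex_of_real (1 / sqrt (l i) * (1 / sqrt (l i)) * l i)"
          unfolding uu col_prod[OF ij(1,2)] by (simp only: True of_real_mult if_True simp_thms)
        thus ?thesis using one True by simp
      next
        case False
        thus ?thesis unfolding uu col_prod[OF ij(1,2)] by simp
      qed
    qed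
    ultimately show ?thesis by (simp add: orthonormal_family_def)
  qed
  moreover have "S \<union> {..<n} = {..<n}" "finite S" by (auto simp: S_def)
  ultimately obtain u' where u': "orthonormal_family d {..<n} u'" "\<And>i. i \<in> S \<Longrightarrow> u' i = u i"
    using orthonormal_family_extend[of "{..<n}" S d u] nd by auto
  define V where "V = mat d n (\<lambda>(i, j). u' j $ i)"
  have V: "isometry d n V" unfolding V_def by (rule isometry_of_family[OF u'(1) nd])
  have Vc: "V \<in> carrier_mat d n" by (simp add: V_def)
  define E where "E = real_diag n (\<lambda>i. sqrt (l i))"
  have E: "E \<in> carrier_mat n n" "mat_adjoint E = E"
    using hermitian_real_diag by (simp_all add: E_def hermitian_def)
  have EE: "E * E = real_diag n l"
    using l0 unfolding E_def real_diag_mult by (intro eq_matI) (auto simp: real_diag_def)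
  have ZVE: "Z = V * E"
  proof (rule eq_matI)
    fix i j assume "i < dim_row (V * E)" "j < dim_col (V * E)"
    hence ij: "i < d" "j < n" using Vc E by auto
    have "Z $$ (i, j) = V $$ (i, j) * complex_of_real (sqrt (l j))"
    proof (cases "l j = 0")
      case True
      hence "col Z j \<bullet>c col Z j = 0" using col_prod[OF ij(2,2)] by simp
      hence "vec_normsq (col Z j) = 0" by (simp add: cscalar_prod_self)
      hence "col Z j = 0\<^sub>v d" using Z vec_normsq_eq_0_iff[of "col Z j"] by simp
      hence "col Z j $ i = 0" using ij by simp
      thus ?thesis using True Z ij by simp
    next
      case False
      hence "u' j = u j" using u'(2) ij by (simp add: S_def)
      hence "V $$ (i, j) = complex_of_real (1 / sqrt (l j)) * Z $$ (i, j)"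
        using ij Z by (simp add: V_def u_def)
      thus ?thesis using False by simp
    qed
    thus "Z $$ (i, j) = (V * E) $$ (i, j)"
      unfolding E_def mult_real_diag_index[OF Vc ij] .
  qed (use Z Vc E in auto)
  have "Y * mat_adjoint Y = Z * mat_adjoint Z"
  proof -
    have "Z * mat_adjoint Z = Y * (Q * (mat_adjoint Q * mat_adjoint Y))"
      unfolding Z_def mat_adjoint_mult[OF Y Qc(1)]
      by (rule assoc_mult_mat[OF Y Qc(1) mult_carrier_mat[OF Qc(2) mat_adjoint_carrier[OF Y]]])
    also have "Q * (mat_adjoint Q * mat_adjoint Y) = mat_adjoint Y"
      using assoc_mult_mat[OF Qc(1,2) mat_adjoint_carrier[OF Y]] isometry_square[OF Q(1)]
        left_mult_one_mat[OF mat_adjoint_carrier[OF Y]] by simp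
    finally show ?thesis by simp
  qed
  also have "\<dots> = V * (E * E) * mat_adjoint V"
    unfolding ZVE mat_adjoint_mult[OF Vc E(1)] E(2)
    by (simp only: assoc_mult_mat[OF Vc E(1) mult_carrier_mat[OF E(1) mat_adjoint_carrier[OF Vc]]]
        assoc_mult_mat[OF Vc mult_carrier_mat[OF E(1) E(1)] mat_adjoint_carrier[OF Vc]]
        assoc_mult_mat[OF E(1) E(1) mat_adjoint_carrier[OF Vc]])
  also have "\<dots> = V * (mat_adjoint Q * G * mat_adjoint (mat_adjoint Q)) * mat_adjoint V"
    using EE D by simp
  also have "\<dots> = (V * mat_adjoint Q) * G * mat_adjoint (V * mat_adjoint Q)"
    by (rule congruence_congruence[OF Vc Qc(2) G(1)])
  finally have "Y * mat_adjoint Y = (V * mat_adjoint Q) * G * mat_adjoint (V * mat_adjoint Q)" .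
  thus ?thesis
    using that[OF isometry_mult[OF V isometry_adjoint[OF Q(1)]]] by (simp add: G_def)
qed

section \<open>Gram matrices of blocks\<close>

lemma bij_betw_pick:
  assumes "finite I"
  shows "bij_betw (pick I) {..<card I} I"
proof -
  have "inj_on (pick I) {..<card I}"
    by (rule linorder_inj_onI) (use pick_mono_le in \<open>force+\<close>)
  moreover have "pick I ` {..<card I} \<subseteq> I" using pick_in_set_le by auto
  ultimately show ?thesis
    using assms by (simp add: bij_betw_def card_image card_subset_eq)
qed

lemma submatrix_carrier:
  assumes "M \<in> carrier_mat n m" "I \<subseteq> {..<n}" "J \<subseteq> {..<m}"
  shows "submatrix M I J \<in> carrier_mat (card I) (card J)"
proof -
  have "{i. i < n \<and> i \<in> I} = I" "{j. j < m \<and> j \<in> J} = J" using assms by auto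
  thus ?thesis using assms(1) by (intro carrier_matI) (auto simp: dim_submatrix)
qed

lemma submatrix_entry:
  assumes "M \<in> carrier_mat n m" "I \<subseteq> {..<n}" "J \<subseteq> {..<m}" "p < card I" "q < card J"
  shows "submatrix M I J $$ (p, q) = M $$ (pick I p, pick J q)"
proof -
  have "{i. i < n \<and> i \<in> I} = I" "{j. j < m \<and> j \<in> J} = J" using assms by auto
  thus ?thesis using assms by (intro submatrix_index) auto
qed

definition gram :: "complex mat \<Rightarrow> nat set \<Rightarrow> nat set \<Rightarrow> complex mat" where
  "gram M I J = mat_adjoint (submatrix M I J) * submatrix M I J"

lemma gram_carrier:
  assumes "M \<in> carrier_mat n m" "I \<subseteq> {..<n}" "J \<subseteq> {..<m}"
  shows "gram M I J \<in> carrier_mat (card J) (card J)"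
  unfolding gram_def by (rule gram_psd(1)[OF submatrix_carrier[OF assms]])

lemma gram_entry:
  assumes M: "M \<in> carrier_mat n m" and I: "I \<subseteq> {..<n}" and J: "J \<subseteq> {..<m}"
    and pq: "p < card J" "q < card J"
  shows "gram M I J $$ (p, q) = (\<Sum>i\<in>I. cnj (M $$ (i, pick J p)) * M $$ (i, pick J q))"
proof -
  note c = submatrix_carrier[OF M I J]
  have "gram M I J $$ (p, q) = (\<Sum>k<card I. cnj (M $$ (pick I k, pick J p)) * M $$ (pick I k, pick J q))"
    unfolding gram_def mat_mult_index_sum[OF mat_adjoint_carrier[OF c] c pq]
    using c pq by (intro sum.cong) (auto simp: submatrix_entry[OF M I J])
  also have "\<dots> = (\<Sum>i\<in>I. cnj (M $$ (i, pick J p)) * M $$ (i, pick J q))"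
    by (rule sum.reindex_bij_betw[OF bij_betw_pick]) (use I finite_subset in blast)
  finally show ?thesis .
qed

lemma gram_row_split:
  assumes M: "M \<in> carrier_mat n m" and I: "I1 \<union> I2 \<subseteq> {..<n}" and J: "J \<subseteq> {..<m}"
    and disj: "I1 \<inter> I2 = {}"
  shows "gram M (I1 \<union> I2) J = gram M I1 J + gram M I2 J"
proof -
  have I': "I1 \<subseteq> {..<n}" "I2 \<subseteq> {..<n}" using I by auto
  note c = gram_carrier[OF M I J] gram_carrier[OF M I'(1) J] gram_carrier[OF M I'(2) J]
  have fin: "finite I1" "finite I2" using I' finite_subset by blast+
  show ?thesis
    by (rule eq_matI)
      (use c in \<open>auto simp: gram_entry[OF M I J] gram_entry[OF M I'(1) J] gram_entry[OF M I'(2) J]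
        sum.union_disjoint[OF fin disj]\<close>)
qed

definition column_selector :: "nat set \<Rightarrow> nat set \<Rightarrow> complex mat" where
  "column_selector J K = mat (card J) (card K) (\<lambda>(s, q). if pick J s = pick K q then 1 else 0)"

lemma column_selector_carrier [simp]: "column_selector J K \<in> carrier_mat (card J) (card K)"
  by (simp add: column_selector_def)

lemma submatrix_mult_column_selector:
  assumes M: "M \<in> carrier_mat n m" and I: "I \<subseteq> {..<n}" and J: "J \<subseteq> {..<m}" and K: "K \<subseteq> J"
  shows "submatrix M I J * column_selector J K = submatrix M I K"
proof (rule eq_matI)
  have K': "K \<subseteq> {..<m}" using K J by auto
  have fin: "finite J" "finite K" using finite_subset[OF J] finite_subset[OF K'] by simp_all
  note c = submatrix_carrier[OF M I J] submatrix_carrier[OF M I K']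
  fix p q assume "p < dim_row (submatrix M I K)" "q < dim_col (submatrix M I K)"
  hence pq: "p < card I" "q < card K" using c by auto
  have "pick K q \<in> J" using pq K pick_in_set_le by blast
  have "(submatrix M I J * column_selector J K) $$ (p, q)
      = (\<Sum>s<card J. if pick J s = pick K q then M $$ (pick I p, pick J s) else 0)"
    unfolding mat_mult_index_sum[OF c(1) column_selector_carrier pq]
    using pq by (intro sum.cong) (auto simp: submatrix_entry[OF M I J] column_selector_def)
  also have "\<dots> = (\<Sum>j\<in>J. if j = pick K q then M $$ (pick I p, j) else 0)"
    by (rule sum.reindex_bij_betw[OF bij_betw_pick[OF fin(1)]])
  also have "\<dots> = M $$ (pick I p, pick K q)" using fin \<open>pick K q \<in> J\<close> by simp
  finally show "(submatrix M I J * column_selector J K) $$ (p, q) = submatrix M I K $$ (p, q)"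
    using submatrix_entry[OF M I K' pq] by simp
qed (use submatrix_carrier[OF M I J] submatrix_carrier[OF M I subset_trans[OF K J]] in \<open>auto simp: column_selector_def\<close>)

lemma column_selector_complete:
  assumes fin: "finite J" and J: "J = J1 \<union> J2" "J1 \<inter> J2 = {}"
  shows "column_selector J J1 * mat_adjoint (column_selector J J1)
    + column_selector J J2 * mat_adjoint (column_selector J J2) = 1\<^sub>m (card J)"
proof -
  have *: "(column_selector J K * mat_adjoint (column_selector J K)) $$ (s, t)
      = (if s = t \<and> pick J s \<in> K then 1 else 0)"
    if K: "K \<subseteq> J" and st: "s < card J" "t < card J" for K s t
  proof -
    have finK: "finite K" using K fin finite_subset by blast
    have "(column_selector J K * mat_adjoint (column_selector J K)) $$ (s, t)
        = (\<Sum>q<card K. if pick K q = pick J s \<and> pick K q = pick J t then 1 else 0)"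
      unfolding mat_mult_index_sum[OF column_selector_carrier mat_adjoint_carrier[OF column_selector_carrier] st]
      using st by (intro sum.cong) (auto simp: column_selector_def)
    also have "\<dots> = (\<Sum>j\<in>K. if j = pick J s \<and> j = pick J t then 1 else 0)"
      by (rule sum.reindex_bij_betw[OF bij_betw_pick[OF finK]])
    also have "\<dots> = (if pick J s = pick J t \<and> pick J s \<in> K then 1 else 0)"
    proof (cases "pick J s = pick J t")
      case True
      thus ?thesis using finK by simp
    next
      case False
      hence "(\<Sum>j\<in>K. if j = pick J s \<and> j = pick J t then 1 else 0) = (\<Sum>j\<in>K. 0 :: complex)"
        by (intro sum.cong) auto
      thus ?thesis using False by simp
    qed
    also have "pick J s = pick J t \<longleftrightarrow> s = t"
      using bij_betw_pick[OF fin] st by (auto simp: bij_betw_def inj_on_def)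
    finally show ?thesis .
  qed
  show ?thesis
  proof (rule eq_matI)
    fix s t assume "s < dim_row (1\<^sub>m (card J) :: complex mat)" "t < dim_col (1\<^sub>m (card J) :: complex mat)"
    hence st: "s < card J" "t < card J" by auto
    have "pick J s \<in> J" using st pick_in_set_le by blast
    thus "(column_selector J J1 * mat_adjoint (column_selector J J1)
      + column_selector J J2 * mat_adjoint (column_selector J J2)) $$ (s, t) = 1\<^sub>m (card J) $$ (s, t)"
      using st J *[of J1 s t] *[of J2 s t]
      by (auto simp: column_selector_def simp del: index_mult_mat(1))
  qed (auto simp: column_selector_def)
qed

text \<open>
  The key step for blocks side by side. Let \<open>N\<close> be the block with columns \<open>J\<close>, so that
  \<open>P\<^sup>2 = N\<^sup>* N\<close>, and let \<open>E\<close> select the columns \<open>K\<close>. Then \<open>Y = P E\<close> satisfies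
  \<open>Y\<^sup>* Y = E\<^sup>* N\<^sup>* N E = (N E)\<^sup>* (N E)\<close>, the Gram matrix of the selected columns, while
  \<open>Y Y\<^sup>* = P E E\<^sup>* P\<close>. These two products are linked by an isometry.
\<close>

lemma gram_column_block:
  assumes M: "M \<in> carrier_mat n m" and I: "I \<subseteq> {..<n}" and J: "J \<subseteq> {..<m}" and K: "K \<subseteq> J"
    and P: "P \<in> carrier_mat (card J) (card J)" "hermitian P" "P * P = gram M I J"
  obtains U where "isometry (card J) (card K) U"
    "P * (column_selector J K * mat_adjoint (column_selector J K)) * P = U * gram M I K * mat_adjoint U"
proof -
  let ?N = "submatrix M I J" and ?E = "column_selector J K"
  note N = submatrix_carrier[OF M I J]
  note N' = mat_adjoint_carrier[OF N]
  have E: "?E \<in> carrier_mat (card J) (card K)" by simp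
  note E' = mat_adjoint_carrier[OF E]
  have Pa: "mat_adjoint P = P" using P(2) by (simp add: hermitian_def)
  note PE = mult_carrier_mat[OF P(1) E]
  have adj: "mat_adjoint (P * ?E) = mat_adjoint ?E * P"
    using mat_adjoint_mult[OF P(1) E] Pa by simp
  have "mat_adjoint (P * ?E) * (P * ?E) = mat_adjoint ?E * (P * P * ?E)"
    unfolding adj by (simp only: assoc_mult_mat[OF E' P(1) PE] assoc_mult_mat[OF P(1) P(1) E])
  also have "\<dots> = mat_adjoint ?E * (mat_adjoint ?N * (?N * ?E))"
    unfolding P(3) gram_def by (simp only: assoc_mult_mat[OF N' N E])
  also have "\<dots> = mat_adjoint (?N * ?E) * (?N * ?E)"
    unfolding mat_adjoint_mult[OF N E]
    by (simp only: assoc_mult_mat[OF E' N' mult_carrier_mat[OF N E]])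
  also have "\<dots> = gram M I K"
    unfolding submatrix_mult_column_selector[OF M I J K] gram_def ..
  finally have YY: "mat_adjoint (P * ?E) * (P * ?E) = gram M I K" .
  have "card K \<le> card J" by (rule card_mono) (use J K finite_subset[OF J] in auto)
  then obtain U where U: "isometry (card J) (card K) U"
    "(P * ?E) * mat_adjoint (P * ?E) = U * gram M I K * mat_adjoint U"
    using adjoint_product_congruence[OF PE] YY by metis
  have "(P * ?E) * mat_adjoint (P * ?E) = P * (?E * mat_adjoint ?E) * P"
    unfolding adj
    by (simp only: assoc_mult_mat[OF P(1) E mult_carrier_mat[OF E' P(1)]]
        assoc_mult_mat[OF P(1) mult_carrier_mat[OF E E'] P(1)] assoc_mult_mat[OF E E' P(1)])
  thus ?thesis using that U by simp
qed

text \<open>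
  Since the two selectors satisfy \<open>E\<^sub>1 E\<^sub>1\<^sup>* + E\<^sub>2 E\<^sub>2\<^sup>* = 1\<close>, for \<open>P = |N|\<close> the matrix
  \<open>P\<^sup>2 = P (E\<^sub>1 E\<^sub>1\<^sup>* + E\<^sub>2 E\<^sub>2\<^sup>*) P\<close> is the sum of the two matrices in the preceding lemma.
\<close>

lemma gram_column_split:
  assumes M: "M \<in> carrier_mat n m" and I: "I \<subseteq> {..<n}" and J: "J1 \<union> J2 \<subseteq> {..<m}"
    and disj: "J1 \<inter> J2 = {}"
  obtains U V where "isometry (card (J1 \<union> J2)) (card J1) U" "isometry (card (J1 \<union> J2)) (card J2) V"
    "gram M I (J1 \<union> J2) = U * gram M I J1 * mat_adjoint U + V * gram M I J2 * mat_adjoint V"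
proof -
  let ?J = "J1 \<union> J2"
  let ?k = "card ?J"
  define F where "F K = column_selector ?J K * mat_adjoint (column_selector ?J K)" for K
  have F: "F K \<in> carrier_mat ?k ?k" for K
    unfolding F_def by (rule mult_carrier_mat[OF column_selector_carrier mat_adjoint_carrier[OF column_selector_carrier]])
  note N = submatrix_carrier[OF M I J]
  define P where "P = mat_abs (submatrix M I ?J)"
  have P: "P \<in> carrier_mat ?k ?k" "hermitian P" "P * P = gram M I ?J"
    using mat_abs[OF N] psd_hermitian by (auto simp: P_def gram_def)
  obtain U where U: "isometry ?k (card J1) U" "P * F J1 * P = U * gram M I J1 * mat_adjoint U"
    using gram_column_block[OF M I J _ P, of J1] unfolding F_def by blast
  obtain V where V: "isometry ?k (card J2) V" "P * F J2 * P = V * gram M I J2 * mat_adjoint V"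
    using gram_column_block[OF M I J _ P, of J2] unfolding F_def by blast
  have "F J1 + F J2 = 1\<^sub>m ?k"
    unfolding F_def by (rule column_selector_complete) (use disj finite_subset[OF J] in auto)
  hence "gram M I ?J = P * (F J1 + F J2) * P" using P by simp
  also have "\<dots> = P * F J1 * P + P * F J2 * P"
    by (simp only: mult_add_distrib_mat[OF P(1) F F]
        add_mult_distrib_mat[OF mult_carrier_mat[OF P(1) F] mult_carrier_mat[OF P(1) F] P(1)])
  finally show ?thesis using that[OF U(1) V(1)] U(2) V(2) by simp
qed

section \<open>Partitions into two or three rectangles\<close>

lemma rectangle_subset:
  assumes "A \<times> B \<noteq> {}" "A \<times> B \<subseteq> I \<times> J" "I \<subseteq> X" "J \<subseteq> Y"
  shows "A \<subseteq> X" "B \<subseteq> Y"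
  using assms by (auto simp: times_subset_iff)

text \<open>
  The argument uses no order on the indices: a rectangle is any product of a set of rows and a
  set of columns. So the complement of a rectangle with a full side is again a rectangle,
  wherever that rectangle lies.
  If some row \<open>i\<close> misses the first rectangle, it lies entirely in the second.
\<close>

lemma two_rectangles_split:
  assumes cover: "I1 \<times> J1 \<union> I2 \<times> J2 = I \<times> J" and disj: "I1 \<times> J1 \<inter> I2 \<times> J2 = {}"
    and ne: "I1 \<times> J1 \<noteq> {}" "I2 \<times> J2 \<noteq> {}"
  shows "J1 = J \<and> J2 = J \<and> I1 \<union> I2 = I \<and> I1 \<inter> I2 = {} \<or>
    I1 = I \<and> I2 = I \<and> J1 \<union> J2 = J \<and> J1 \<inter> J2 = {}"
proof -
  have sub: "I1 \<subseteq> I" "I2 \<subseteq> I" "J1 \<subseteq> J" "J2 \<subseteq> J" using cover ne by blast+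
  have mem: "i \<in> I1 \<and> j \<in> J1 \<or> i \<in> I2 \<and> j \<in> J2" if "i \<in> I" "j \<in> J" for i j
    using cover that by blast
  have no: "\<not> (i \<in> I1 \<and> j \<in> J1 \<and> i \<in> I2 \<and> j \<in> J2)" for i j
    using disj by blast
  show ?thesis
  proof (cases "I1 = I")
    case True
    have J12: "J1 \<inter> J2 = {}" using no ne True sub by blast
    hence "I2 = I" using mem ne True sub by blast
    moreover have "J1 \<union> J2 = J" using mem ne True sub by blast
    ultimately show ?thesis using J12 True by blast
  next
    case False
    then obtain i where i: "i \<in> I" "i \<notin> I1" using sub by blast
    hence J2: "J2 = J" using mem[OF i(1)] sub by blast
    hence I12: "I1 \<inter> I2 = {}" using no ne sub by blast
    hence "J1 = J" using mem ne J2 sub by blast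
    moreover have "I1 \<union> I2 = I" using mem ne sub by blast
    ultimately show ?thesis using J2 I12 by blast
  qed
qed

text \<open>
  Suppose that no rectangle has a full side. A row that misses the first rectangle meets both
  of the others, and these share the columns between them. In a column belonging to the second rectangle,
  a row outside the second rectangle can only be in the first one, and likewise for the third.
  So the first rectangle contains every column.
\<close>

lemma three_rectangles_full_side:
  assumes cover: "I1 \<times> J1 \<union> I2 \<times> J2 \<union> I3 \<times> J3 = I \<times> J"
    and disj: "I1 \<times> J1 \<inter> I2 \<times> J2 = {}" "I1 \<times> J1 \<inter> I3 \<times> J3 = {}" "I2 \<times> J2 \<inter> I3 \<times> J3 = {}"
    and ne: "I1 \<times> J1 \<noteq> {}" "I2 \<times> J2 \<noteq> {}" "I3 \<times> J3 \<noteq> {}"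
  shows "I1 = I \<or> J1 = J \<or> I2 = I \<or> J2 = J \<or> I3 = I \<or> J3 = J"
proof (rule ccontr)
  assume "\<not> ?thesis"
  hence nf: "I1 \<noteq> I" "J1 \<noteq> J" "I2 \<noteq> I" "J2 \<noteq> J" "I3 \<noteq> I" "J3 \<noteq> J" by auto
  have sub: "I1 \<subseteq> I" "I2 \<subseteq> I" "I3 \<subseteq> I" "J1 \<subseteq> J" "J2 \<subseteq> J" "J3 \<subseteq> J" using cover ne by blast+
  have mem: "i \<in> I1 \<and> j \<in> J1 \<or> i \<in> I2 \<and> j \<in> J2 \<or> i \<in> I3 \<and> j \<in> J3" if "i \<in> I" "j \<in> J" for i j
    using cover that by blast
  obtain i where i: "i \<in> I" "i \<notin> I1" using nf(1) sub(1) by blast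
  have rowi: "i \<in> I2 \<and> j \<in> J2 \<or> i \<in> I3 \<and> j \<in> J3" if "j \<in> J" for j using mem[OF i(1) that] i(2) by blast
  obtain j2 where j2: "j2 \<in> J" "j2 \<notin> J2" using nf(4) sub by blast
  obtain j3 where j3: "j3 \<in> J" "j3 \<notin> J3" using nf(6) sub by blast
  have i23: "i \<in> I2" "i \<in> I3" using rowi[OF j2(1)] rowi[OF j3(1)] j2(2) j3(2) by blast+
  have J23: "J2 \<inter> J3 = {}" using disj(3) i23 by blast
  obtain i2 where i2: "i2 \<in> I" "i2 \<notin> I2" using nf(3) sub by blast
  obtain i3 where i3: "i3 \<in> I" "i3 \<notin> I3" using nf(5) sub by blast
  have "j \<in> J1" if j: "j \<in> J" for j
  proof (cases "j \<in> J2")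
    case True
    hence "j \<notin> J3" using J23 by blast
    thus ?thesis using mem[OF i2(1) j] i2(2) by blast
  next
    case False
    thus ?thesis using mem[OF i3(1) j] i3(2) by blast
  qed
  thus False using nf(2) sub(4) by blast
qed

lemma complement_of_full_side:
  assumes "A \<times> B \<union> R = I \<times> J" "A \<times> B \<inter> R = {}" "A \<times> B \<noteq> {}" "A = I \<or> B = J"
  shows "\<exists>I' J'. R = I' \<times> J'"
proof -
  have sub: "A \<subseteq> I" "B \<subseteq> J" using assms(1,3) by blast+
  have "R = I \<times> J - A \<times> B" using assms(1,2) by blast
  also have "\<dots> = (if A = I then I \<times> (J - B) else (I - A) \<times> J)" using assms(4) sub by auto
  finally show ?thesis by metis
qed

text \<open>
  The complement of a rectangle with a full side is a rectangle, so every partition into three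
  rectangles arises by two successive straight cuts.
\<close>

lemma three_rectangles_cut:
  assumes cover: "I1 \<times> J1 \<union> I2 \<times> J2 \<union> I3 \<times> J3 = I \<times> J"
    and disj: "I1 \<times> J1 \<inter> I2 \<times> J2 = {}" "I1 \<times> J1 \<inter> I3 \<times> J3 = {}" "I2 \<times> J2 \<inter> I3 \<times> J3 = {}"
    and ne: "I1 \<times> J1 \<noteq> {}" "I2 \<times> J2 \<noteq> {}" "I3 \<times> J3 \<noteq> {}"
  shows "\<exists>I' J'. I2 \<times> J2 \<union> I3 \<times> J3 = I' \<times> J' \<or> I1 \<times> J1 \<union> I3 \<times> J3 = I' \<times> J' \<or>
    I1 \<times> J1 \<union> I2 \<times> J2 = I' \<times> J'"
proof -
  have 1: "I1 \<times> J1 \<union> (I2 \<times> J2 \<union> I3 \<times> J3) = I \<times> J" "I1 \<times> J1 \<inter> (I2 \<times> J2 \<union> I3 \<times> J3) = {}"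
   and 2: "I2 \<times> J2 \<union> (I1 \<times> J1 \<union> I3 \<times> J3) = I \<times> J" "I2 \<times> J2 \<inter> (I1 \<times> J1 \<union> I3 \<times> J3) = {}"
   and 3: "I3 \<times> J3 \<union> (I1 \<times> J1 \<union> I2 \<times> J2) = I \<times> J" "I3 \<times> J3 \<inter> (I1 \<times> J1 \<union> I2 \<times> J2) = {}"
    using cover disj by (simp_all add: Un_ac Int_Un_distrib Int_commute)
  consider "I1 = I \<or> J1 = J" | "I2 = I \<or> J2 = J" | "I3 = I \<or> J3 = J"
    using three_rectangles_full_side[OF assms] by blast
  thus ?thesis
    using complement_of_full_side[OF 1 ne(1)] complement_of_full_side[OF 2 ne(2)]
      complement_of_full_side[OF 3 ne(3)] by cases metis+
qed

section \<open>The Pythagorean identity for blocks\<close>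

text \<open>
  For one block above the other, the Gram matrices simply add up and the isometries are
  identities; blocks side by side need \<open>gram_column_split\<close>.
\<close>

lemma gram_two_blocks:
  assumes M: "M \<in> carrier_mat n m" and I: "I \<subseteq> {..<n}" and J: "J \<subseteq> {..<m}"
    and R: "I1 \<times> J1 \<union> I2 \<times> J2 = I \<times> J" "I1 \<times> J1 \<inter> I2 \<times> J2 = {}" "I1 \<times> J1 \<noteq> {}" "I2 \<times> J2 \<noteq> {}"
  obtains U V where "isometry (card J) (card J1) U" "isometry (card J) (card J2) V"
    "gram M I J = U * gram M I1 J1 * mat_adjoint U + V * gram M I2 J2 * mat_adjoint V"
  using two_rectangles_split[OF R]
proof
  assume rows: "J1 = J \<and> J2 = J \<and> I1 \<union> I2 = I \<and> I1 \<inter> I2 = {}"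
  hence I': "I1 \<union> I2 \<subseteq> {..<n}" "I1 \<subseteq> {..<n}" "I2 \<subseteq> {..<n}" using I by auto
  have one: "1\<^sub>m (card J) * G * mat_adjoint (1\<^sub>m (card J)) = G" if "G \<in> carrier_mat (card J) (card J)" for G :: "complex mat"
  proof -
    have "mat_adjoint (1\<^sub>m (card J)) = (1\<^sub>m (card J) :: complex mat)" by (rule eq_matI) auto
    thus ?thesis using that by simp
  qed
  have "gram M I J = gram M I1 J1 + gram M I2 J2"
    using gram_row_split[OF M I'(1) J] rows by simp
  thus ?thesis
    using that[of "1\<^sub>m (card J)" "1\<^sub>m (card J)"] rows isometry_one
      one[OF gram_carrier[OF M I'(2) J]] one[OF gram_carrier[OF M I'(3) J]] by simp
next
  assume cols: "I1 = I \<and> I2 = I \<and> J1 \<union> J2 = J \<and> J1 \<inter> J2 = {}"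
  thus ?thesis using gram_column_split[OF M I, of J1 J2] J that by metis
qed

lemma gram_three_blocks_if_cut:
  assumes M: "M \<in> carrier_mat n m" and I: "I \<subseteq> {..<n}" and J: "J \<subseteq> {..<m}"
    and cover: "I1 \<times> J1 \<union> I2 \<times> J2 \<union> I3 \<times> J3 = I \<times> J"
    and disj: "I1 \<times> J1 \<inter> I2 \<times> J2 = {}" "I1 \<times> J1 \<inter> I3 \<times> J3 = {}" "I2 \<times> J2 \<inter> I3 \<times> J3 = {}"
    and ne: "I1 \<times> J1 \<noteq> {}" "I2 \<times> J2 \<noteq> {}" "I3 \<times> J3 \<noteq> {}"
    and cut: "I2 \<times> J2 \<union> I3 \<times> J3 = I' \<times> J'"
  shows "\<exists>U V W. isometry (card J) (card J1) U \<and> isometry (card J) (card J2) V \<and> isometry (card J) (card J3) W \<and>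
    gram M I J = U * gram M I1 J1 * mat_adjoint U +
      (V * gram M I2 J2 * mat_adjoint V + W * gram M I3 J3 * mat_adjoint W)"
proof -
  \<comment> \<open>Cut off the first block, then cut the remaining rectangle; the isometries compose.\<close>
  have outer: "I1 \<times> J1 \<union> I' \<times> J' = I \<times> J" "I1 \<times> J1 \<inter> I' \<times> J' = {}" "I' \<times> J' \<noteq> {}"
    using cover disj ne unfolding cut[symmetric] by (simp_all add: Un_assoc Int_Un_distrib)
  have sub: "I1 \<subseteq> {..<n}" "I2 \<subseteq> {..<n}" "I3 \<subseteq> {..<n}" "I' \<subseteq> {..<n}"
    "J1 \<subseteq> {..<m}" "J2 \<subseteq> {..<m}" "J3 \<subseteq> {..<m}" "J' \<subseteq> {..<m}"
    using rectangle_subset[OF ne(1) _ I J] rectangle_subset[OF ne(2) _ I J]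
      rectangle_subset[OF ne(3) _ I J] rectangle_subset[OF outer(3) _ I J]
    by (simp_all only: cover[symmetric] le_supI1 le_supI2 order_refl cut[symmetric] Un_least)
  obtain U T where U: "isometry (card J) (card J1) U" and T: "isometry (card J) (card J') T"
    and G: "gram M I J = U * gram M I1 J1 * mat_adjoint U + T * gram M I' J' * mat_adjoint T"
    using gram_two_blocks[OF M I J outer(1,2) ne(1) outer(3)] .
  obtain V W where V: "isometry (card J') (card J2) V" and W: "isometry (card J') (card J3) W"
    and G': "gram M I' J' = V * gram M I2 J2 * mat_adjoint V + W * gram M I3 J3 * mat_adjoint W"
    using gram_two_blocks[OF M sub(4,8) cut disj(3) ne(2,3)] .
  have c: "T \<in> carrier_mat (card J) (card J')" "V \<in> carrier_mat (card J') (card J2)"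
    "W \<in> carrier_mat (card J') (card J3)"
    using T V W by (auto simp: isometry_def)
  note g = gram_carrier[OF M sub(2,6)] gram_carrier[OF M sub(3,7)]
  have X: "V * gram M I2 J2 * mat_adjoint V \<in> carrier_mat (card J') (card J')"
    "W * gram M I3 J3 * mat_adjoint W \<in> carrier_mat (card J') (card J')"
    by (rule mult_carrier_mat[OF mult_carrier_mat[OF c(2) g(1)] mat_adjoint_carrier[OF c(2)]]
      mult_carrier_mat[OF mult_carrier_mat[OF c(3) g(2)] mat_adjoint_carrier[OF c(3)]])+
  have "T * gram M I' J' * mat_adjoint T
      = T * (V * gram M I2 J2 * mat_adjoint V) * mat_adjoint T
        + T * (W * gram M I3 J3 * mat_adjoint W) * mat_adjoint T"
    unfolding G' mult_add_distrib_mat[OF c(1) X]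
    by (rule add_mult_distrib_mat[OF mult_carrier_mat[OF c(1) X(1)] mult_carrier_mat[OF c(1) X(2)]
          mat_adjoint_carrier[OF c(1)]])
  also have "\<dots> = (T * V) * gram M I2 J2 * mat_adjoint (T * V) + (T * W) * gram M I3 J3 * mat_adjoint (T * W)"
    by (simp only: congruence_congruence[OF c(1,2) g(1)] congruence_congruence[OF c(1,3) g(2)])
  finally show ?thesis using G U isometry_mult[OF T V] isometry_mult[OF T W] by metis
qed

lemma congruence_carrier:
  assumes "U \<in> carrier_mat n m" "A \<in> carrier_mat m m"
  shows "U * A * mat_adjoint U \<in> carrier_mat n n"
  by (rule mult_carrier_mat[OF mult_carrier_mat[OF assms] mat_adjoint_carrier[OF assms(1)]])

lemma gram_three_blocks:
  assumes M: "M \<in> carrier_mat n m" and I: "I \<subseteq> {..<n}" and J: "J \<subseteq> {..<m}"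
    and cover: "I1 \<times> J1 \<union> I2 \<times> J2 \<union> I3 \<times> J3 = I \<times> J"
    and disj: "I1 \<times> J1 \<inter> I2 \<times> J2 = {}" "I1 \<times> J1 \<inter> I3 \<times> J3 = {}" "I2 \<times> J2 \<inter> I3 \<times> J3 = {}"
    and ne: "I1 \<times> J1 \<noteq> {}" "I2 \<times> J2 \<noteq> {}" "I3 \<times> J3 \<noteq> {}"
  obtains U V W where "isometry (card J) (card J1) U" "isometry (card J) (card J2) V"
    "isometry (card J) (card J3) W"
    "gram M I J = U * gram M I1 J1 * mat_adjoint U + V * gram M I2 J2 * mat_adjoint V
      + W * gram M I3 J3 * mat_adjoint W"
proof -
  let ?k = "card J"
  have sub: "I1 \<subseteq> {..<n}" "I2 \<subseteq> {..<n}" "I3 \<subseteq> {..<n}" "J1 \<subseteq> {..<m}" "J2 \<subseteq> {..<m}" "J3 \<subseteq> {..<m}"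
    using rectangle_subset[OF ne(1) _ I J] rectangle_subset[OF ne(2) _ I J]
      rectangle_subset[OF ne(3) _ I J]
    by (simp_all only: cover[symmetric] le_supI1 le_supI2 order_refl)
  have G: "V * gram M I1 J1 * mat_adjoint V \<in> carrier_mat ?k ?k" if "isometry ?k (card J1) V" for V
    using congruence_carrier[OF _ gram_carrier[OF M sub(1,4)]] that by (auto simp: isometry_def)
  have G2: "V * gram M I2 J2 * mat_adjoint V \<in> carrier_mat ?k ?k" if "isometry ?k (card J2) V" for V
    using congruence_carrier[OF _ gram_carrier[OF M sub(2,5)]] that by (auto simp: isometry_def)
  have G3: "V * gram M I3 J3 * mat_adjoint V \<in> carrier_mat ?k ?k" if "isometry ?k (card J3) V" for V
    using congruence_carrier[OF _ gram_carrier[OF M sub(3,6)]] that by (auto simp: isometry_def)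
  have cover': "I2 \<times> J2 \<union> I1 \<times> J1 \<union> I3 \<times> J3 = I \<times> J" "I3 \<times> J3 \<union> I1 \<times> J1 \<union> I2 \<times> J2 = I \<times> J"
    and disj': "I2 \<times> J2 \<inter> I1 \<times> J1 = {}" "I3 \<times> J3 \<inter> I1 \<times> J1 = {}" "I3 \<times> J3 \<inter> I2 \<times> J2 = {}"
    using cover disj by blast+
  obtain I' J' where "I2 \<times> J2 \<union> I3 \<times> J3 = I' \<times> J' \<or> I1 \<times> J1 \<union> I3 \<times> J3 = I' \<times> J' \<or>
    I1 \<times> J1 \<union> I2 \<times> J2 = I' \<times> J'"
    using three_rectangles_cut[OF cover disj ne] by (elim exE) (rule that)
  then consider (c1) "I2 \<times> J2 \<union> I3 \<times> J3 = I' \<times> J'" | (c2) "I1 \<times> J1 \<union> I3 \<times> J3 = I' \<times> J'"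
    | (c3) "I1 \<times> J1 \<union> I2 \<times> J2 = I' \<times> J'" by (elim disjE)
  thus ?thesis
  proof cases
    case c1
    obtain U V W where *: "isometry ?k (card J1) U" "isometry ?k (card J2) V" "isometry ?k (card J3) W"
      "gram M I J = U * gram M I1 J1 * mat_adjoint U +
        (V * gram M I2 J2 * mat_adjoint V + W * gram M I3 J3 * mat_adjoint W)"
      using gram_three_blocks_if_cut[OF M I J cover disj ne c1]
      by (elim exE conjE) (rule that)
    show ?thesis
      by (rule that[OF *(1,2,3)]) (simp only: *(4) assoc_add_mat[OF G[OF *(1)] G2[OF *(2)] G3[OF *(3)]])
  next
    case c2
    obtain V U W where *: "isometry ?k (card J2) V" "isometry ?k (card J1) U" "isometry ?k (card J3) W"
      "gram M I J = V * gram M I2 J2 * mat_adjoint V +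
        (U * gram M I1 J1 * mat_adjoint U + W * gram M I3 J3 * mat_adjoint W)"
      using gram_three_blocks_if_cut[OF M I J cover'(1) disj'(1) disj(3,2) ne(2,1,3) c2]
      by (elim exE conjE) (rule that)
    show ?thesis
      by (rule that[OF *(2,1,3)]) (simp only: *(4) assoc_add_mat[OF G2[OF *(1)] G[OF *(2)] G3[OF *(3)], symmetric]
        comm_add_mat[OF G2[OF *(1)] G[OF *(2)]])
  next
    case c3
    obtain W U V where *: "isometry ?k (card J3) W" "isometry ?k (card J1) U" "isometry ?k (card J2) V"
      "gram M I J = W * gram M I3 J3 * mat_adjoint W +
        (U * gram M I1 J1 * mat_adjoint U + V * gram M I2 J2 * mat_adjoint V)"
      using gram_three_blocks_if_cut[OF M I J cover'(2) disj'(2,3) disj(1) ne(3,1,2) c3]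
      by (elim exE conjE) (rule that)
    show ?thesis
      by (rule that[OF *(2,3,1)])
        (simp only: *(4) comm_add_mat[OF G3[OF *(1)] add_carrier_mat[OF G2[OF *(3)]]])
  qed
qed

section \<open>The upper bounds\<close>

lemma vec_normsq_add:
  assumes "a \<in> carrier_vec n" "b \<in> carrier_vec n"
  shows "vec_normsq (a + b) \<le> 2 * (vec_normsq a + vec_normsq b)"
proof -
  have "(cmod (a $ i + b $ i))\<^sup>2 \<le> 2 * ((cmod (a $ i))\<^sup>2 + (cmod (b $ i))\<^sup>2)" for i
  proof -
    have "(cmod (a $ i + b $ i))\<^sup>2 \<le> (cmod (a $ i) + cmod (b $ i))\<^sup>2"
      by (intro power_mono norm_triangle_ineq) simp
    also have "\<dots> \<le> 2 * ((cmod (a $ i))\<^sup>2 + (cmod (b $ i))\<^sup>2)"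
      using zero_le_power2[of "cmod (a $ i) - cmod (b $ i)"]
      by (simp add: power2_sum power2_diff)
    finally show ?thesis .
  qed
  hence "(\<Sum>i<n. (cmod (a $ i + b $ i))\<^sup>2) \<le> (\<Sum>i<n. 2 * ((cmod (a $ i))\<^sup>2 + (cmod (b $ i))\<^sup>2))"
    by (intro sum_mono)
  thus ?thesis using assms by (simp add: vec_normsq_def sum.distrib flip: sum_distrib_left)
qed

lemma vec_normsq_add3:
  assumes "a \<in> carrier_vec n" "b \<in> carrier_vec n" "c \<in> carrier_vec n"
  shows "vec_normsq (a + b + c) \<le> 3 * (vec_normsq a + vec_normsq b + vec_normsq c)"
proof -
  have "(cmod (a $ i + b $ i + c $ i))\<^sup>2 \<le> 3 * ((cmod (a $ i))\<^sup>2 + (cmod (b $ i))\<^sup>2 + (cmod (c $ i))\<^sup>2)" for i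
  proof -
    define x y z where xyz: "x = cmod (a $ i)" "y = cmod (b $ i)" "z = cmod (c $ i)"
    have "cmod (a $ i + b $ i + c $ i) \<le> x + y + z"
      unfolding xyz by (rule order_trans[OF norm_triangle_ineq]) (intro add_right_mono norm_triangle_ineq)
    hence "(cmod (a $ i + b $ i + c $ i))\<^sup>2 \<le> (x + y + z)\<^sup>2"
      by (intro power_mono) auto
    also have "\<dots> \<le> 3 * (x\<^sup>2 + y\<^sup>2 + z\<^sup>2)"
      using zero_le_power2[of "x - y"] zero_le_power2[of "x - z"] zero_le_power2[of "y - z"]
      by (simp add: power2_eq_square algebra_simps)
    finally show ?thesis unfolding xyz .
  qed
  hence "(\<Sum>i<n. (cmod (a $ i + b $ i + c $ i))\<^sup>2)
      \<le> (\<Sum>i<n. 3 * ((cmod (a $ i))\<^sup>2 + (cmod (b $ i))\<^sup>2 + (cmod (c $ i))\<^sup>2))"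
    by (intro sum_mono)
  thus ?thesis using assms by (simp add: vec_normsq_def sum.distrib del: assoc_add_vec flip: sum_distrib_left)
qed

lemma vec_normsq_smult: "vec_normsq (c \<cdot>\<^sub>v v) = (cmod c)\<^sup>2 * vec_normsq v"
  by (simp add: vec_normsq_def norm_mult power_mult_distrib sum_distrib_left)

lemma psd_add:
  assumes A: "psd A" "A \<in> carrier_mat n n" and B: "psd B" "B \<in> carrier_mat n n"
  shows "psd (A + B)"
proof -
  have c: "A + B \<in> carrier_mat n n" using A B by simp
  have "hermitian (A + B)"
    using mat_adjoint_add[OF A(2) B(2)] psd_hermitian[OF A(1)] psd_hermitian[OF B(1)]
    by (simp add: hermitian_def)
  moreover have "0 \<le> Re (((A + B) *\<^sub>v v) \<bullet>c v)" if v: "v \<in> carrier_vec n" for v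
  proof -
    have "((A + B) *\<^sub>v v) \<bullet>c v = (A *\<^sub>v v) \<bullet>c v + (B *\<^sub>v v) \<bullet>c v"
      unfolding add_mult_distrib_mat_vec[OF A(2) B(2) v]
      by (rule add_scalar_prod_distrib[of _ n]) (use A B v in auto)
    thus ?thesis using psd_form_nonneg[OF A v] psd_form_nonneg[OF B v] by simp
  qed
  ultimately show ?thesis by (simp add: psd_iff[OF c])
qed

lemma smult_mat_mult_vec:
  fixes A :: "complex mat"
  assumes A: "A \<in> carrier_mat n m" and v: "v \<in> carrier_vec m"
  shows "(c \<cdot>\<^sub>m A) *\<^sub>v v = c \<cdot>\<^sub>v (A *\<^sub>v v)"
proof (rule eq_vecI)
  fix i assume "i < dim_vec (c \<cdot>\<^sub>v (A *\<^sub>v v))"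
  hence i: "i < n" using A by simp
  have cA: "c \<cdot>\<^sub>m A \<in> carrier_mat n m" using A by simp
  have "((c \<cdot>\<^sub>m A) *\<^sub>v v) $ i = (\<Sum>l<m. c * (A $$ (i, l) * v $ l))"
    unfolding mult_mat_vec_sum[OF cA v i] using A i by (intro sum.cong) auto
  also have "\<dots> = c * (A *\<^sub>v v) $ i"
    unfolding mult_mat_vec_sum[OF A v i] by (simp add: sum_distrib_left)
  also have "\<dots> = (c \<cdot>\<^sub>v (A *\<^sub>v v)) $ i" using A i by (subst index_smult_vec) auto
  finally show "((c \<cdot>\<^sub>m A) *\<^sub>v v) $ i = (c \<cdot>\<^sub>v (A *\<^sub>v v)) $ i" .
qed (use A in simp)

lemma psd_smult:
  assumes A: "psd A" "A \<in> carrier_mat n n" and r: "0 \<le> r"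
  shows "psd (complex_of_real r \<cdot>\<^sub>m A)"
proof -
  have c: "complex_of_real r \<cdot>\<^sub>m A \<in> carrier_mat n n" using A by simp
  have "hermitian (complex_of_real r \<cdot>\<^sub>m A)"
    using psd_hermitian[OF A(1)] by (simp add: hermitian_def mat_adjoint_smult)
  moreover have "0 \<le> Re (((complex_of_real r \<cdot>\<^sub>m A) *\<^sub>v v) \<bullet>c v)" if v: "v \<in> carrier_vec n" for v
  proof -
    have "A *\<^sub>v v \<in> carrier_vec n" using A v by simp
    hence "((complex_of_real r \<cdot>\<^sub>m A) *\<^sub>v v) \<bullet>c v = complex_of_real r * ((A *\<^sub>v v) \<bullet>c v)"
      unfolding smult_mat_mult_vec[OF A(2) v] using v by simp
    thus ?thesis using psd_form_nonneg[OF A v] r by simp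
  qed
  ultimately show ?thesis by (simp add: psd_iff[OF c])
qed

lemma loewner_if_norm_le:
  assumes S: "psd S" "S \<in> carrier_mat n n" and T: "psd T" "T \<in> carrier_mat n n"
    and le: "\<And>v. v \<in> carrier_vec n \<Longrightarrow> vec_normsq (S *\<^sub>v v) \<le> vec_normsq (T *\<^sub>v v)"
  shows "T \<ge>\<^sub>L S"
  unfolding loewner_ge_def
  using S T psd_diff_if_norm_le[OF S T] le psd_hermitian by (auto simp: cscalar_prod_self)

lemma mat_abs_congruence:
  assumes A: "A \<in> carrier_mat k m" and U: "isometry n m U"
  shows "psd (U * mat_abs A * mat_adjoint U)" "U * mat_abs A * mat_adjoint U \<in> carrier_mat n n"
    "(U * mat_abs A * mat_adjoint U) * (U * mat_abs A * mat_adjoint U)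
      = U * (mat_adjoint A * A) * mat_adjoint U"
proof -
  have Uc: "U \<in> carrier_mat n m" using U by (simp add: isometry_def)
  show "psd (U * mat_abs A * mat_adjoint U)" by (rule psd_congruence[OF mat_abs(1,2)[OF A] Uc])
  show "U * mat_abs A * mat_adjoint U \<in> carrier_mat n n"
    by (rule congruence_carrier[OF Uc mat_abs(2)[OF A]])
  show "(U * mat_abs A * mat_adjoint U) * (U * mat_abs A * mat_adjoint U)
      = U * (mat_adjoint A * A) * mat_adjoint U"
    unfolding congruence_mult[OF U mat_abs(2)[OF A] mat_abs(2)[OF A]] mat_abs(3)[OF A] ..
qed

lemma psd_normsq:
  assumes "psd R" "R \<in> carrier_mat n n" "v \<in> carrier_vec n"
  shows "vec_normsq (R *\<^sub>v v) = Re (((R * R) *\<^sub>v v) \<bullet>c v)"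
  using psd_norm_square[OF assms] cscalar_prod_self[of "R *\<^sub>v v"] by (metis Re_complex_of_real)

text \<open>
  \<open>(X + Y)\<^sup>2 \<le> 2 (X\<^sup>2 + Y\<^sup>2) = (\<surd>2 |M|)\<^sup>2\<close> holds vector by vector, and the square root is
  operator monotone.
\<close>

lemma loewner_two_squares:
  assumes M: "M \<in> carrier_mat d n"
    and X: "psd X" "X \<in> carrier_mat n n" and Y: "psd Y" "Y \<in> carrier_mat n n"
    and eq: "mat_adjoint M * M = X * X + Y * Y"
  shows "complex_of_real (sqrt 2) \<cdot>\<^sub>m mat_abs M \<ge>\<^sub>L X + Y"
proof (rule loewner_if_norm_le)
  note R = mat_abs[OF M]
  show "psd (X + Y)" by (rule psd_add[OF X Y])
  show "psd (complex_of_real (sqrt 2) \<cdot>\<^sub>m mat_abs M)" by (rule psd_smult[OF R(1,2)]) simp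
  show "X + Y \<in> carrier_mat n n" "complex_of_real (sqrt 2) \<cdot>\<^sub>m mat_abs M \<in> carrier_mat n n"
    using X Y R by auto
  fix v :: "complex vec" assume v: "v \<in> carrier_vec n"
  have c: "X *\<^sub>v v \<in> carrier_vec n" "Y *\<^sub>v v \<in> carrier_vec n" using X Y v by auto
  have sq: "X * X \<in> carrier_mat n n" "Y * Y \<in> carrier_mat n n" using X Y by auto
  have "vec_normsq ((X + Y) *\<^sub>v v) \<le> 2 * (vec_normsq (X *\<^sub>v v) + vec_normsq (Y *\<^sub>v v))"
    unfolding add_mult_distrib_mat_vec[OF X(2) Y(2) v] by (rule vec_normsq_add[OF c])
  also have "vec_normsq (X *\<^sub>v v) + vec_normsq (Y *\<^sub>v v) = Re (((X * X + Y * Y) *\<^sub>v v) \<bullet>c v)"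
  proof -
    have "((X * X + Y * Y) *\<^sub>v v) \<bullet>c v = ((X * X) *\<^sub>v v) \<bullet>c v + ((Y * Y) *\<^sub>v v) \<bullet>c v"
      unfolding add_mult_distrib_mat_vec[OF sq v]
      by (rule add_scalar_prod_distrib[of _ n]) (use sq v in auto)
    thus ?thesis using psd_normsq[OF X v] psd_normsq[OF Y v] by simp
  qed
  also have "\<dots> = vec_normsq (mat_abs M *\<^sub>v v)"
    using psd_normsq[OF R(1,2) v] R(3) eq by simp
  also have "2 * vec_normsq (mat_abs M *\<^sub>v v) = vec_normsq ((complex_of_real (sqrt 2) \<cdot>\<^sub>m mat_abs M) *\<^sub>v v)"
    unfolding smult_mat_mult_vec[OF R(2) v] vec_normsq_smult by simp
  finally show "vec_normsq ((X + Y) *\<^sub>v v) \<le> vec_normsq ((complex_of_real (sqrt 2) \<cdot>\<^sub>m mat_abs M) *\<^sub>v v)" .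
qed

lemma loewner_three_squares:
  assumes M: "M \<in> carrier_mat d n"
    and X: "psd X" "X \<in> carrier_mat n n" and Y: "psd Y" "Y \<in> carrier_mat n n"
    and Z: "psd Z" "Z \<in> carrier_mat n n"
    and eq: "mat_adjoint M * M = X * X + Y * Y + Z * Z"
  shows "complex_of_real (sqrt 3) \<cdot>\<^sub>m mat_abs M \<ge>\<^sub>L X + Y + Z"
proof (rule loewner_if_norm_le)
  note R = mat_abs[OF M]
  have XY: "X + Y \<in> carrier_mat n n" using X Y by simp
  show "psd (X + Y + Z)" by (rule psd_add[OF psd_add[OF X Y] XY Z])
  show "psd (complex_of_real (sqrt 3) \<cdot>\<^sub>m mat_abs M)" by (rule psd_smult[OF R(1,2)]) simp
  show "X + Y + Z \<in> carrier_mat n n" "complex_of_real (sqrt 3) \<cdot>\<^sub>m mat_abs M \<in> carrier_mat n n"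
    using X Y Z R by auto
  fix v :: "complex vec" assume v: "v \<in> carrier_vec n"
  have c: "X *\<^sub>v v \<in> carrier_vec n" "Y *\<^sub>v v \<in> carrier_vec n" "Z *\<^sub>v v \<in> carrier_vec n"
    using X Y Z v by auto
  have sq: "X * X \<in> carrier_mat n n" "Y * Y \<in> carrier_mat n n" "Z * Z \<in> carrier_mat n n"
    using X Y Z by auto
  have sq': "X * X + Y * Y \<in> carrier_mat n n" using sq by simp
  have "vec_normsq ((X + Y + Z) *\<^sub>v v)
      \<le> 3 * (vec_normsq (X *\<^sub>v v) + vec_normsq (Y *\<^sub>v v) + vec_normsq (Z *\<^sub>v v))"
    unfolding add_mult_distrib_mat_vec[OF XY Z(2) v] add_mult_distrib_mat_vec[OF X(2) Y(2) v]
    by (rule vec_normsq_add3[OF c])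
  also have "vec_normsq (X *\<^sub>v v) + vec_normsq (Y *\<^sub>v v) + vec_normsq (Z *\<^sub>v v)
      = Re (((X * X + Y * Y + Z * Z) *\<^sub>v v) \<bullet>c v)"
  proof -
    have d: "((P + Q) *\<^sub>v v) \<bullet>c v = (P *\<^sub>v v) \<bullet>c v + (Q *\<^sub>v v) \<bullet>c v"
      if "P \<in> carrier_mat n n" "Q \<in> carrier_mat n n" for P Q :: "complex mat"
      unfolding add_mult_distrib_mat_vec[OF that v]
      by (rule add_scalar_prod_distrib[of _ n]) (use that v in auto)
    show ?thesis unfolding d[OF sq' sq(3)] d[OF sq(1,2)]
      using psd_normsq[OF X v] psd_normsq[OF Y v] psd_normsq[OF Z v] by simp
  qed
  also have "\<dots> = vec_normsq (mat_abs M *\<^sub>v v)"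
    using psd_normsq[OF R(1,2) v] R(3) eq by simp
  also have "3 * vec_normsq (mat_abs M *\<^sub>v v) = vec_normsq ((complex_of_real (sqrt 3) \<cdot>\<^sub>m mat_abs M) *\<^sub>v v)"
    unfolding smult_mat_mult_vec[OF R(2) v] vec_normsq_smult by simp
  finally show "vec_normsq ((X + Y + Z) *\<^sub>v v)
    \<le> vec_normsq ((complex_of_real (sqrt 3) \<cdot>\<^sub>m mat_abs M) *\<^sub>v v)" .
qed

lemma pick_lessThan:
  assumes "p < n"
  shows "pick {..<n} p = p"
proof -
  have "{a \<in> {..<n}. a < p} = {..<p}" using assms by auto
  thus ?thesis using pick_card_in_set[of p "{..<n}"] assms by simp
qed

lemma submatrix_full:
  assumes M: "M \<in> carrier_mat n m"
  shows "submatrix M {..<n} {..<m} = M"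
proof (rule eq_matI)
  fix i j assume "i < dim_row M" "j < dim_col M"
  hence ij: "i < n" "j < m" using M by auto
  thus "submatrix M {..<n} {..<m} $$ (i, j) = M $$ (i, j)"
    using submatrix_entry[OF M, of "{..<n}" "{..<m}" i j] by (simp add: pick_lessThan)
qed (use M submatrix_carrier[OF M, of "{..<n}" "{..<m}"] in auto)

lemma loewner_two_blocks:
  assumes M: "M \<in> carrier_mat d n" and part: "partitioned_into M [A, B]"
  shows "\<exists>U V. isometry n (dim_col A) U \<and> isometry n (dim_col B) V \<and>
    complex_of_real (sqrt 2) \<cdot>\<^sub>m mat_abs M \<ge>\<^sub>L
      U * mat_abs A * mat_adjoint U + V * mat_abs B * mat_adjoint V"
proof -
  obtain Rs where Rs: "rect_partition d n Rs" "[A, B] = map (\<lambda>(I, J). submatrix M I J) Rs"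
    using part M by (auto simp: partitioned_into_def)
  then obtain R1 R2 where R12: "Rs = [R1, R2]" by (auto simp: map_eq_Cons_conv Cons_eq_map_conv)
  obtain I1 J1 I2 J2 where R: "R1 = (I1, J1)" "R2 = (I2, J2)" by fastforce
  have AB: "A = submatrix M I1 J1" "B = submatrix M I2 J2" using Rs(2) by (simp_all add: R12 R)
  have D: "distinct [I1 \<times> J1, I2 \<times> J2]" and
    P: "partition_on ({..<d} \<times> {..<n}) {I1 \<times> J1, I2 \<times> J2}"
    using Rs(1) by (simp_all add: rect_partition_def R12 R)
  have cover: "I1 \<times> J1 \<union> I2 \<times> J2 = {..<d} \<times> {..<n}"
    using partition_onD1[OF P] by (simp only: Union_insert Union_empty Un_empty_right)
  have disj: "I1 \<times> J1 \<inter> I2 \<times> J2 = {}"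
    using D by (intro disjointD[OF partition_onD2[OF P]]; simp)
  have ne: "I1 \<times> J1 \<noteq> {}" "I2 \<times> J2 \<noteq> {}"
    using partition_onD3[OF P] by (simp_all only: insert_iff de_Morgan_disj) auto
  have sub: "I1 \<subseteq> {..<d}" "I2 \<subseteq> {..<d}" "J1 \<subseteq> {..<n}" "J2 \<subseteq> {..<n}"
    using rectangle_subset[OF ne(1) _ order_refl[of "{..<d}"] order_refl[of "{..<n}"]] rectangle_subset[OF ne(2) _ order_refl[of "{..<d}"] order_refl[of "{..<n}"]]
    by (simp_all only: cover[symmetric] le_supI1 le_supI2 order_refl)
  have Ac: "A \<in> carrier_mat (card I1) (card J1)" and Bc: "B \<in> carrier_mat (card I2) (card J2)"
    unfolding AB by (rule submatrix_carrier[OF M sub(1,3)] submatrix_carrier[OF M sub(2,4)])+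
  obtain U V where U: "isometry n (card J1) U" and V: "isometry n (card J2) V"
    and G: "gram M {..<d} {..<n} = U * gram M I1 J1 * mat_adjoint U + V * gram M I2 J2 * mat_adjoint V"
    using gram_two_blocks[OF M order_refl order_refl cover disj ne] unfolding card_lessThan .
  note X = mat_abs_congruence[OF Ac U] and Y = mat_abs_congruence[OF Bc V]
  have "mat_adjoint M * M
      = (U * mat_abs A * mat_adjoint U) * (U * mat_abs A * mat_adjoint U)
        + (V * mat_abs B * mat_adjoint V) * (V * mat_abs B * mat_adjoint V)"
    by (simp only: X(3) Y(3) G[unfolded gram_def submatrix_full[OF M], folded AB])
  from loewner_two_squares[OF M X(1,2) Y(1,2) this]
  show ?thesis using U V Ac Bc by (metis carrier_matD(2))
qed

lemma loewner_three_blocks: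
  assumes M: "M \<in> carrier_mat d n" and part: "partitioned_into M [A, B, C]"
  shows "\<exists>U V W. isometry n (dim_col A) U \<and> isometry n (dim_col B) V \<and> isometry n (dim_col C) W \<and>
    complex_of_real (sqrt 3) \<cdot>\<^sub>m mat_abs M \<ge>\<^sub>L
      U * mat_abs A * mat_adjoint U + V * mat_abs B * mat_adjoint V + W * mat_abs C * mat_adjoint W"
proof -
  obtain Rs where Rs: "rect_partition d n Rs" "[A, B, C] = map (\<lambda>(I, J). submatrix M I J) Rs"
    using part M by (auto simp: partitioned_into_def)
  then obtain R1 R2 R3 where R123: "Rs = [R1, R2, R3]" by (auto simp: map_eq_Cons_conv Cons_eq_map_conv)
  obtain I1 J1 I2 J2 I3 J3 where R: "R1 = (I1, J1)" "R2 = (I2, J2)" "R3 = (I3, J3)"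
    by (cases R1, cases R2, cases R3) simp
  have ABC: "A = submatrix M I1 J1" "B = submatrix M I2 J2" "C = submatrix M I3 J3"
    using Rs(2) by (simp_all add: R123 R)
  have D: "distinct [I1 \<times> J1, I2 \<times> J2, I3 \<times> J3]" and
    P: "partition_on ({..<d} \<times> {..<n}) {I1 \<times> J1, I2 \<times> J2, I3 \<times> J3}"
    using Rs(1) by (simp_all add: rect_partition_def R123 R)
  have cover: "I1 \<times> J1 \<union> I2 \<times> J2 \<union> I3 \<times> J3 = {..<d} \<times> {..<n}"
    using partition_onD1[OF P] by (simp only: Union_insert Union_empty Un_empty_right Un_assoc)
  have disj: "I1 \<times> J1 \<inter> I2 \<times> J2 = {}" "I1 \<times> J1 \<inter> I3 \<times> J3 = {}" "I2 \<times> J2 \<inter> I3 \<times> J3 = {}"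
    using D by (intro disjointD[OF partition_onD2[OF P]]; simp)+
  have ne: "I1 \<times> J1 \<noteq> {}" "I2 \<times> J2 \<noteq> {}" "I3 \<times> J3 \<noteq> {}"
    using partition_onD3[OF P] by (simp_all only: insert_iff de_Morgan_disj) auto
  have sub: "I1 \<subseteq> {..<d}" "I2 \<subseteq> {..<d}" "I3 \<subseteq> {..<d}" "J1 \<subseteq> {..<n}" "J2 \<subseteq> {..<n}" "J3 \<subseteq> {..<n}"
    using rectangle_subset[OF ne(1) _ order_refl[of "{..<d}"] order_refl[of "{..<n}"]] rectangle_subset[OF ne(2) _ order_refl[of "{..<d}"] order_refl[of "{..<n}"]]
      rectangle_subset[OF ne(3) _ order_refl[of "{..<d}"] order_refl[of "{..<n}"]]
    by (simp_all only: cover[symmetric] le_supI1 le_supI2 order_refl)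
  have Ac: "A \<in> carrier_mat (card I1) (card J1)" and Bc: "B \<in> carrier_mat (card I2) (card J2)"
    and Cc: "C \<in> carrier_mat (card I3) (card J3)"
    unfolding ABC by (rule submatrix_carrier[OF M sub(1,4)] submatrix_carrier[OF M sub(2,5)]
        submatrix_carrier[OF M sub(3,6)])+
  obtain U V W where U: "isometry n (card J1) U" and V: "isometry n (card J2) V"
    and W: "isometry n (card J3) W"
    and G: "gram M {..<d} {..<n} = U * gram M I1 J1 * mat_adjoint U + V * gram M I2 J2 * mat_adjoint V
      + W * gram M I3 J3 * mat_adjoint W"
    using gram_three_blocks[OF M order_refl order_refl cover disj ne] unfolding card_lessThan .
  note X = mat_abs_congruence[OF Ac U] and Y = mat_abs_congruence[OF Bc V]
    and Z = mat_abs_congruence[OF Cc W]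
  have "mat_adjoint M * M
      = (U * mat_abs A * mat_adjoint U) * (U * mat_abs A * mat_adjoint U)
        + (V * mat_abs B * mat_adjoint V) * (V * mat_abs B * mat_adjoint V)
        + (W * mat_abs C * mat_adjoint W) * (W * mat_abs C * mat_adjoint W)"
    by (simp only: X(3) Y(3) Z(3) G[unfolded gram_def submatrix_full[OF M], folded ABC])
  from loewner_three_squares[OF M X(1,2) Y(1,2) Z(1,2) this]
  show ?thesis using U V W Ac Bc Cc by (metis carrier_matD(2))
qed

section \<open>Optimality of the constants\<close>

definition mat_trace :: "complex mat \<Rightarrow> complex" where
  "mat_trace A = (\<Sum>i<dim_row A. A $$ (i, i))"

lemma mat_trace_comm:
  assumes A: "A \<in> carrier_mat n m" and B: "B \<in> carrier_mat m n"
  shows "mat_trace (A * B) = mat_trace (B * A)"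
proof -
  have d: "dim_row A = n" "dim_row B = m" using A B by auto
  have "mat_trace (A * B) = (\<Sum>i<n. \<Sum>l<m. A $$ (i, l) * B $$ (l, i))"
    unfolding mat_trace_def index_mult_mat(2) d
    by (intro sum.cong refl) (rule mat_mult_index_sum[OF A B], simp_all)
  also have "\<dots> = (\<Sum>l<m. \<Sum>i<n. B $$ (l, i) * A $$ (i, l))"
    by (subst sum.swap) (simp add: mult.commute)
  also have "\<dots> = mat_trace (B * A)"
    unfolding mat_trace_def index_mult_mat(2) d
    by (intro sum.cong refl) (rule mat_mult_index_sum[OF B A, symmetric], simp_all)
  finally show ?thesis .
qed

text \<open>
  Traces turn the Loewner inequality into a numerical one from which the isometries disappear.
\<close>

lemma mat_trace_congruence:
  assumes U: "isometry n m U" and A: "A \<in> carrier_mat m m"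
  shows "mat_trace (U * A * mat_adjoint U) = mat_trace A"
proof -
  have Uc: "U \<in> carrier_mat n m" "mat_adjoint U * U = 1\<^sub>m m" using U by (auto simp: isometry_def)
  note U' = mat_adjoint_carrier[OF Uc(1)]
  have "mat_trace (U * A * mat_adjoint U) = mat_trace (mat_adjoint U * (U * A))"
    by (rule mat_trace_comm[OF mult_carrier_mat[OF Uc(1) A] U'])
  also have "mat_adjoint U * (U * A) = A"
    using assoc_mult_mat[OF U' Uc(1) A] Uc(2) left_mult_one_mat[OF A] by simp
  finally show ?thesis .
qed

lemma mat_trace_add:
  assumes "A \<in> carrier_mat n n" "B \<in> carrier_mat n n"
  shows "mat_trace (A + B) = mat_trace A + mat_trace B"
  using assms by (simp add: mat_trace_def sum.distrib)

lemma mat_trace_minus: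
  assumes "A \<in> carrier_mat n n" "B \<in> carrier_mat n n"
  shows "mat_trace (A - B) = mat_trace A - mat_trace B"
  using assms by (simp add: mat_trace_def sum_subtractf)

lemma mat_trace_smult:
  assumes "A \<in> carrier_mat n n"
  shows "mat_trace (c \<cdot>\<^sub>m A) = c * mat_trace A"
  using assms by (simp add: mat_trace_def sum_distrib_left)

lemma psd_trace_nonneg:
  assumes A: "psd A" "A \<in> carrier_mat n n"
  shows "0 \<le> Re (mat_trace A)"
proof -
  have "0 \<le> Re (A $$ (i, i))" if i: "i < n" for i
  proof -
    have "(A *\<^sub>v unit_vec n i) \<bullet>c unit_vec n i
        = (\<Sum>j<n. if j = i then A $$ (i, i) else 0)"
      unfolding mult_mat_unit_vec[OF A(2) i] cscalar_prod_sum[OF unit_vec_carrier]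
      using A(2) i by (intro sum.cong) auto
    hence "(A *\<^sub>v unit_vec n i) \<bullet>c unit_vec n i = A $$ (i, i)" using i by simp
    thus ?thesis using psd_form_nonneg[OF A unit_vec_carrier[of n i]] by simp
  qed
  thus ?thesis using A(2) by (auto simp: mat_trace_def intro!: sum_nonneg)
qed

lemma gram_trace_pos:
  assumes S: "S \<in> carrier_mat m n" and S0: "S \<noteq> 0\<^sub>m m n"
  shows "0 < Re (mat_trace (mat_adjoint S * S))"
proof -
  have "\<exists>i j. i < m \<and> j < n \<and> S $$ (i, j) \<noteq> 0"
  proof (rule ccontr)
    assume "\<not> ?thesis"
    hence "S = 0\<^sub>m m n" using S by (intro eq_matI) auto
    thus False using S0 by simp
  qed
  then obtain i j where ij: "i < m" "j < n" "S $$ (i, j) \<noteq> 0" by blast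
  have "dim_col S = n" using S by simp
  hence "mat_trace (mat_adjoint S * S) = (\<Sum>q<n. (mat_adjoint S * S) $$ (q, q))"
    by (simp only: mat_trace_def index_mult_mat(2) dim_mat_adjoint)
  also have "\<dots> = (\<Sum>q<n. \<Sum>l<m. mat_adjoint S $$ (q, l) * S $$ (l, q))"
    by (intro sum.cong refl) (rule mat_mult_index_sum[OF mat_adjoint_carrier[OF S] S], simp_all)
  also have "\<dots> = (\<Sum>q<n. \<Sum>l<m. complex_of_real ((cmod (S $$ (l, q)))\<^sup>2))"
    using S by (intro sum.cong refl) (auto simp: complex_norm_square mult.commute simp del: of_real_power)
  finally have eq: "Re (mat_trace (mat_adjoint S * S)) = (\<Sum>q<n. \<Sum>l<m. (cmod (S $$ (l, q)))\<^sup>2)"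
    by simp
  have pos: "0 < (\<Sum>l<m. (cmod (S $$ (l, j)))\<^sup>2)"
    by (rule sum_pos2[of _ i]) (use ij in auto)
  have "0 < (\<Sum>q<n. \<Sum>l<m. (cmod (S $$ (l, q)))\<^sup>2)"
    by (rule sum_pos2[of _ j]) (use ij pos in \<open>auto intro: sum_nonneg\<close>)
  thus ?thesis using eq by simp
qed

text \<open>
  Writing \<open>|A| = K\<^sup>* K\<close> makes the trace of \<open>|A|\<close> a sum of squared moduli.
\<close>

lemma mat_abs_trace_pos:
  assumes A: "A \<in> carrier_mat m n" and A0: "A \<noteq> 0\<^sub>m m n"
  shows "0 < Re (mat_trace (mat_abs A))"
proof -
  note R = mat_abs[OF A]
  obtain K where K: "psd K" "K \<in> carrier_mat n n" "K * K = mat_abs A"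
    using psd_sqrt_exists[OF R(1,2)] by blast
  have "K \<noteq> 0\<^sub>m n n"
  proof
    assume "K = 0\<^sub>m n n"
    hence "mat_abs A = 0\<^sub>m n n" using K(3)[symmetric] by simp
    hence "mat_adjoint A * A = 0\<^sub>m n n" using R(3)[symmetric] by simp
    thus False using gram_trace_pos[OF A A0] by (simp add: mat_trace_def)
  qed
  hence "0 < Re (mat_trace (mat_adjoint K * K))" by (rule gram_trace_pos[OF K(2)])
  thus ?thesis using K(3) psd_hermitian[OF K(1)] by (simp add: hermitian_def)
qed

text \<open>
  The extremal example: all rows of \<open>M\<close> coincide, so \<open>M\<^sup>* M\<close> is \<open>k\<close> times the Gram matrix
  of one row, and \<open>|M|\<close> is only \<open>\<surd>k\<close> times the absolute value of one row although there are \<open>k\<close> rows.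
\<close>

definition repeated_row :: "nat \<Rightarrow> complex vec \<Rightarrow> complex mat" where
  "repeated_row k r = mat k (dim_vec r) (\<lambda>(i, j). r $ j)"

lemma repeated_row_carrier: "repeated_row k r \<in> carrier_mat k (dim_vec r)"
  by (simp add: repeated_row_def)

lemma mat_of_row_eq_repeated_row: "mat_of_row r = repeated_row 1 r"
  by (rule eq_matI) (auto simp: mat_of_row_def repeated_row_def)

lemma row_repeated_row: "i < k \<Longrightarrow> row (repeated_row k r) i = r"
  by (rule eq_vecI) (auto simp: repeated_row_def)

lemma repeated_row_gram:
  "mat_adjoint (repeated_row k r) * repeated_row k r
    = mat (dim_vec r) (dim_vec r) (\<lambda>(p, q). of_nat k * (cnj (r $ p) * r $ q))"
proof (rule eq_matI)
  let ?n = "dim_vec r"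
  let ?G = "mat ?n ?n (\<lambda>(p, q). of_nat k * (cnj (r $ p) * r $ q))"
  fix p q assume "p < dim_row ?G" "q < dim_col ?G"
  hence pq: "p < ?n" "q < ?n" by auto
  show "(mat_adjoint (repeated_row k r) * repeated_row k r) $$ (p, q) = ?G $$ (p, q)"
    unfolding mat_mult_index_sum[OF mat_adjoint_carrier[OF repeated_row_carrier] repeated_row_carrier pq]
    using pq by (simp add: repeated_row_def)
qed (simp_all add: repeated_row_def)

lemma mat_abs_repeated_row:
  "mat_abs (repeated_row k r) = complex_of_real (sqrt (real k)) \<cdot>\<^sub>m mat_abs (mat_of_row r)"
proof -
  let ?n = "dim_vec r" and ?s = "complex_of_real (sqrt (real k))"
  have A: "mat_of_row r \<in> carrier_mat 1 ?n" unfolding mat_of_row_eq_repeated_row by (rule repeated_row_carrier)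
  note R = mat_abs[OF A]
  have sR: "?s \<cdot>\<^sub>m mat_abs (mat_of_row r) \<in> carrier_mat ?n ?n" using R(2) by simp
  have ss: "?s * ?s = of_nat k"
    by (metis abs_of_nat of_real_mult of_real_of_nat_eq real_sqrt_mult_self)
  have "(?s \<cdot>\<^sub>m mat_abs (mat_of_row r)) * (?s \<cdot>\<^sub>m mat_abs (mat_of_row r))
      = ?s \<cdot>\<^sub>m (?s \<cdot>\<^sub>m (mat_abs (mat_of_row r) * mat_abs (mat_of_row r)))"
    unfolding mult_smult_assoc_mat[OF R(2) sR] mult_smult_distrib[OF R(2,2)] ..
  also have "\<dots> = mat_adjoint (repeated_row k r) * repeated_row k r"
    unfolding R(3) unfolding mat_of_row_eq_repeated_row repeated_row_gram
    by (rule eq_matI) (auto simp: mult.assoc[symmetric] ss)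
  finally have "mat_adjoint (repeated_row k r) * repeated_row k r
    = (?s \<cdot>\<^sub>m mat_abs (mat_of_row r)) * (?s \<cdot>\<^sub>m mat_abs (mat_of_row r))" ..
  thus ?thesis
    unfolding mat_abs_def[of "repeated_row k r"]
    using psd_sqrt_eqI[OF psd_smult[OF R(1,2)] sR] by simp
qed

lemma repeated_row_partition:
  assumes "dim_vec r \<noteq> 0"
  shows "partitioned_into (repeated_row k r) (replicate k (mat_of_row r))"
proof -
  let ?n = "dim_vec r"
  let ?M = "repeated_row k r"
  define Rs where "Rs = map (\<lambda>i. ({i..<Suc i}, {0..<?n})) [0..<k]"
  have inj: "inj_on (\<lambda>i. {i..<Suc i} \<times> {0..<?n}) X" for X
    using assms by (auto simp: inj_on_def times_eq_iff)
  have "{0..<?n} \<noteq> {}" using assms by (simp only: atLeastLessThan_empty_iff not_gr_zero not_False_eq_True)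
  hence ne: "{} \<noteq> {i} \<times> {0..<?n}" for i :: nat by blast
  have blocks: "map (\<lambda>(I, J). I \<times> J) Rs = map (\<lambda>i. {i..<Suc i} \<times> {0..<?n}) [0..<k]"
    by (simp add: Rs_def)
  have "partition_on ({..<k} \<times> {..<?n}) ((\<lambda>i. {i..<Suc i} \<times> {0..<?n}) ` {0..<k})"
    by (rule partition_onI) (use ne in \<open>auto simp: disjnt_def\<close>)
  moreover have interval: "\<exists>a b. {i} = {a..<b}" for i :: nat
    by (intro exI[of _ i] exI[of _ "Suc i"]) auto
  ultimately have "rect_partition k ?n Rs"
    unfolding rect_partition_def blocks using inj interval
    by (auto simp: distinct_map Rs_def)
  moreover have "submatrix ?M {i..<Suc i} {0..<?n} = mat_of_row r" if i: "i < k" for i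
  proof -
    have I: "{i..<Suc i} \<subseteq> {..<k}" "{i..<Suc i} = {i}" using i by auto
    have J: "{0..<?n} = {..<?n}" "{0..<?n} \<subseteq> {..<?n}" by auto
    note c = submatrix_carrier[OF repeated_row_carrier I(1) J(2)]
    show ?thesis
    proof (rule eq_matI)
      fix p q assume "p < dim_row (mat_of_row r)" "q < dim_col (mat_of_row r)"
      hence pq: "p = 0" "q < ?n" by (auto simp: mat_of_row_def)
      have "pick {i} 0 = i" by (rule singletonD, rule pick_in_set_le) simp
      have "submatrix ?M {i..<Suc i} {0..<?n} $$ (p, q) = ?M $$ (pick {i..<Suc i} p, pick {0..<?n} q)"
        by (rule submatrix_entry[OF repeated_row_carrier I(1) J(2)]) (use pq in auto)
      also have "\<dots> = ?M $$ (i, q)" unfolding I(2) J(1) pq(1) \<open>pick {i} 0 = i\<close> pick_lessThan[OF pq(2)] ..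
      finally show "submatrix ?M {i..<Suc i} {0..<?n} $$ (p, q) = mat_of_row r $$ (p, q)"
        using pq i by (simp add: repeated_row_def mat_of_row_def)
    qed (use c in \<open>auto simp: mat_of_row_def\<close>)
  qed
  hence "map (\<lambda>(I, J). submatrix ?M I J) Rs = replicate k (mat_of_row r)"
    by (auto simp: Rs_def intro!: nth_equalityI)
  moreover have "dim_row ?M = k" "dim_col ?M = ?n" by (simp_all add: repeated_row_def)
  ultimately show ?thesis unfolding partitioned_into_def by metis
qed

text \<open>
  Taking traces of both sides, with \<open>t > 0\<close> the trace of the absolute value of one row, gives
  \<open>c \<surd>k t \<ge> k t\<close>.
\<close>

lemma repeated_row_bound:
  assumes r: "r \<noteq> 0\<^sub>v (dim_vec r)" and k: "0 < k"
    and S: "S \<in> carrier_mat (dim_vec r) (dim_vec r)"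
    and tr: "mat_trace S = of_nat k * mat_trace (mat_abs (mat_of_row r))"
    and le: "complex_of_real c \<cdot>\<^sub>m mat_abs (repeated_row k r) \<ge>\<^sub>L S"
  shows "sqrt (real k) \<le> c"
proof -
  let ?n = "dim_vec r" and ?s = "sqrt (real k)"
  let ?R = "mat_abs (mat_of_row r)"
  have A: "mat_of_row r \<in> carrier_mat 1 ?n" unfolding mat_of_row_eq_repeated_row by (rule repeated_row_carrier)
  note R = mat_abs[OF A]
  have "mat_of_row r \<noteq> 0\<^sub>m 1 ?n"
  proof
    assume "mat_of_row r = 0\<^sub>m 1 ?n"
    hence "mat_of_row r $$ (0, j) = 0" if "j < ?n" for j using that by simp
    hence "r = 0\<^sub>v ?n" by (intro eq_vecI) (auto simp: mat_of_row_def)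
    thus False using r by simp
  qed
  hence t: "0 < Re (mat_trace ?R)" by (rule mat_abs_trace_pos[OF A])
  have sR: "complex_of_real ?s \<cdot>\<^sub>m ?R \<in> carrier_mat ?n ?n"
    and csR: "complex_of_real c \<cdot>\<^sub>m (complex_of_real ?s \<cdot>\<^sub>m ?R) \<in> carrier_mat ?n ?n" using R(2) by auto
  have "psd (complex_of_real c \<cdot>\<^sub>m (complex_of_real ?s \<cdot>\<^sub>m ?R) - S)"
    using le unfolding loewner_ge_def mat_abs_repeated_row by simp
  hence "0 \<le> Re (mat_trace (complex_of_real c \<cdot>\<^sub>m (complex_of_real ?s \<cdot>\<^sub>m ?R) - S))"
    by (rule psd_trace_nonneg) (use minus_carrier_mat[OF S] in blast)
  also have "mat_trace (complex_of_real c \<cdot>\<^sub>m (complex_of_real ?s \<cdot>\<^sub>m ?R) - S)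
      = complex_of_real (c * ?s - real k) * mat_trace ?R"
    unfolding mat_trace_minus[OF csR S] mat_trace_smult[OF sR] mat_trace_smult[OF R(2)] tr
    by (simp add: algebra_simps)
  finally have "0 \<le> (c * ?s - real k) * Re (mat_trace ?R)" by simp
  hence "0 \<le> c * ?s - real k" using t by (simp add: zero_le_mult_iff)
  hence "?s * ?s \<le> c * ?s" by simp
  thus ?thesis by (rule mult_right_le_imp_le) (use k in simp)
qed

lemma repeated_row_no_two_isometries:
  assumes r: "r \<noteq> 0\<^sub>v (dim_vec r)" and c: "c < sqrt 2"
    and UV: "isometry (dim_vec r) (dim_vec r) U" "isometry (dim_vec r) (dim_vec r) V"
  defines "R \<equiv> mat_abs (mat_of_row r)"
  shows "\<not> complex_of_real c \<cdot>\<^sub>m mat_abs (repeated_row 2 r) \<ge>\<^sub>L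
    U * R * mat_adjoint U + V * R * mat_adjoint V"
proof
  assume le: "complex_of_real c \<cdot>\<^sub>m mat_abs (repeated_row 2 r) \<ge>\<^sub>L
    U * R * mat_adjoint U + V * R * mat_adjoint V"
  have R: "R \<in> carrier_mat (dim_vec r) (dim_vec r)"
    unfolding R_def mat_of_row_eq_repeated_row by (rule mat_abs(2)[OF repeated_row_carrier])
  have X: "T * R * mat_adjoint T \<in> carrier_mat (dim_vec r) (dim_vec r)"
    if "isometry (dim_vec r) (dim_vec r) T" for T
    using congruence_carrier[OF _ R] that by (simp add: isometry_def)
  have "mat_trace (U * R * mat_adjoint U + V * R * mat_adjoint V) = of_nat 2 * mat_trace R"
    by (simp add: mat_trace_add[OF X[OF UV(1)] X[OF UV(2)]] mat_trace_congruence[OF UV(1) R]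
        mat_trace_congruence[OF UV(2) R])
  hence "sqrt (real 2) \<le> c"
    by (intro repeated_row_bound[OF r _ _ _ le]) (use X[OF UV(1)] X[OF UV(2)] in \<open>simp_all add: R_def\<close>)
  thus False using c by simp
qed

lemma repeated_row_no_three_isometries:
  assumes r: "r \<noteq> 0\<^sub>v (dim_vec r)" and c: "c < sqrt 3"
    and UVW: "isometry (dim_vec r) (dim_vec r) U" "isometry (dim_vec r) (dim_vec r) V"
      "isometry (dim_vec r) (dim_vec r) W"
  defines "R \<equiv> mat_abs (mat_of_row r)"
  shows "\<not> complex_of_real c \<cdot>\<^sub>m mat_abs (repeated_row 3 r) \<ge>\<^sub>L
    U * R * mat_adjoint U + V * R * mat_adjoint V + W * R * mat_adjoint W"
proof
  assume le: "complex_of_real c \<cdot>\<^sub>m mat_abs (repeated_row 3 r) \<ge>\<^sub>L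
    U * R * mat_adjoint U + V * R * mat_adjoint V + W * R * mat_adjoint W"
  have R: "R \<in> carrier_mat (dim_vec r) (dim_vec r)"
    unfolding R_def mat_of_row_eq_repeated_row by (rule mat_abs(2)[OF repeated_row_carrier])
  have X: "T * R * mat_adjoint T \<in> carrier_mat (dim_vec r) (dim_vec r)"
    if "isometry (dim_vec r) (dim_vec r) T" for T
    using congruence_carrier[OF _ R] that by (simp add: isometry_def)
  note X' = X[OF UVW(1)] X[OF UVW(2)] X[OF UVW(3)]
  have XY: "U * R * mat_adjoint U + V * R * mat_adjoint V \<in> carrier_mat (dim_vec r) (dim_vec r)"
    using X' by simp
  have "mat_trace (U * R * mat_adjoint U + V * R * mat_adjoint V + W * R * mat_adjoint W)
      = of_nat 3 * mat_trace R"
    by (simp add: mat_trace_add[OF XY X'(3)] mat_trace_add[OF X'(1,2)] mat_trace_congruence[OF UVW(1) R]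
        mat_trace_congruence[OF UVW(2) R] mat_trace_congruence[OF UVW(3) R])
  hence "sqrt (real 3) \<le> c"
    by (intro repeated_row_bound[OF r _ _ _ le]) (use XY X' in \<open>simp_all add: R_def\<close>)
  thus False using c by simp
qed

lemma three_equal_rows:
  "mat_of_rows_list 3 [[x, y, z], [x, y, z], [x, y, z]] = repeated_row 3 (vec 3 (\<lambda>j. [x, y, z] ! j))"
proof (rule eq_matI)
  fix i j assume "i < dim_row (repeated_row 3 (vec 3 (\<lambda>j. [x, y, z] ! j)))"
    "j < dim_col (repeated_row 3 (vec 3 (\<lambda>j. [x, y, z] ! j)))"
  hence "i < 3" "j < 3" by (auto simp: repeated_row_def)
  hence "i \<in> {0, 1, 2}" "j < 3" by auto
  thus "mat_of_rows_list 3 [[x, y, z], [x, y, z], [x, y, z]] $$ (i, j)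
      = repeated_row 3 (vec 3 (\<lambda>j. [x, y, z] ! j)) $$ (i, j)"
    by (auto simp: mat_of_rows_list_def repeated_row_def)
qed (auto simp: mat_of_rows_list_def repeated_row_def)

theorem mainTheorem5:
  shows
    "(\<forall>(d::nat) (d'::nat) (M::complex mat) (A::complex mat) (B::complex mat) (C::complex mat).
        M \<in> carrier_mat d d' \<longrightarrow> partitioned_into M [A, B, C] \<longrightarrow>
        (\<exists>U V W. isometry d' (dim_col A) U \<and> isometry d' (dim_col B) V \<and>
           isometry d' (dim_col C) W \<and>
           complex_of_real (sqrt 3) \<cdot>\<^sub>m mat_abs M \<ge>\<^sub>L
             U * mat_abs A * mat_adjoint U + V * mat_abs B * mat_adjoint V
               + W * mat_abs C * mat_adjoint W))
     \<and>
     (\<forall>(x::complex) (y::complex) (z::complex). (x, y, z) \<noteq> (0, 0, 0) \<longrightarrow>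
        (let M = mat_of_rows_list 3 [[x, y, z], [x, y, z], [x, y, z]];
             A = mat_of_row (row M 0);
             B = mat_of_row (row M 1);
             C = mat_of_row (row M 2)
         in partitioned_into M [A, B, C] \<and>
            (\<forall>c::real. c < sqrt 3 \<longrightarrow>
               \<not> (\<exists>U V W. isometry 3 (dim_col A) U \<and> isometry 3 (dim_col B) V \<and>
                    isometry 3 (dim_col C) W \<and>
                    complex_of_real c \<cdot>\<^sub>m mat_abs M \<ge>\<^sub>L
                      U * mat_abs A * mat_adjoint U + V * mat_abs B * mat_adjoint V
                        + W * mat_abs C * mat_adjoint W))))
     \<and>
     (\<forall>(d::nat) (d'::nat) (M::complex mat) (A::complex mat) (B::complex mat).
        M \<in> carrier_mat d d' \<longrightarrow> partitioned_into M [A, B] \<longrightarrow>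
        (\<exists>U V. isometry d' (dim_col A) U \<and> isometry d' (dim_col B) V \<and>
           complex_of_real (sqrt 2) \<cdot>\<^sub>m mat_abs M \<ge>\<^sub>L
             U * mat_abs A * mat_adjoint U + V * mat_abs B * mat_adjoint V))
     \<and>
     (\<forall>c::real. c < sqrt 2 \<longrightarrow>
        \<not> (\<forall>(d::nat) (d'::nat) (M::complex mat) (A::complex mat) (B::complex mat).
             M \<in> carrier_mat d d' \<longrightarrow> partitioned_into M [A, B] \<longrightarrow>
             (\<exists>U V. isometry d' (dim_col A) U \<and> isometry d' (dim_col B) V \<and>
                complex_of_real c \<cdot>\<^sub>m mat_abs M \<ge>\<^sub>L
                  U * mat_abs A * mat_adjoint U + V * mat_abs B * mat_adjoint V)))"
proof (intro conjI allI impI)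
  fix d d' :: nat and M A B C :: "complex mat"
  assume "M \<in> carrier_mat d d'" "partitioned_into M [A, B, C]"
  thus "\<exists>U V W. isometry d' (dim_col A) U \<and> isometry d' (dim_col B) V \<and>
      isometry d' (dim_col C) W \<and>
      complex_of_real (sqrt 3) \<cdot>\<^sub>m mat_abs M \<ge>\<^sub>L
        U * mat_abs A * mat_adjoint U + V * mat_abs B * mat_adjoint V
          + W * mat_abs C * mat_adjoint W"
    by (rule loewner_three_blocks)
next
  fix x y z :: complex
  assume xyz: "(x, y, z) \<noteq> (0, 0, 0)"
  define r where "r = vec 3 (\<lambda>j. [x, y, z] ! j)"
  have dim: "dim_vec r = 3" by (simp add: r_def)
  have r0: "r \<noteq> 0\<^sub>v (dim_vec r)"
  proof
    assume "r = 0\<^sub>v (dim_vec r)"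
    hence "r $ 0 = 0" "r $ 1 = 0" "r $ 2 = 0" unfolding dim by simp_all
    thus False using xyz by (simp add: r_def)
  qed
  have rows: "row (repeated_row 3 r) 0 = r" "row (repeated_row 3 r) 1 = r"
    "row (repeated_row 3 r) 2 = r" by (simp_all add: row_repeated_row)
  have cols: "dim_col (mat_of_row r) = 3" by (simp add: mat_of_row_def dim)
  have "partitioned_into (repeated_row 3 r) [mat_of_row r, mat_of_row r, mat_of_row r]"
    using repeated_row_partition[of r 3] dim by (simp add: numeral_3_eq_3)
  thus "let M = mat_of_rows_list 3 [[x, y, z], [x, y, z], [x, y, z]];
           A = mat_of_row (row M 0);
           B = mat_of_row (row M 1);
           C = mat_of_row (row M 2)
       in partitioned_into M [A, B, C] \<and>
          (\<forall>c::real. c < sqrt 3 \<longrightarrow>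
             \<not> (\<exists>U V W. isometry 3 (dim_col A) U \<and> isometry 3 (dim_col B) V \<and>
                  isometry 3 (dim_col C) W \<and>
                  complex_of_real c \<cdot>\<^sub>m mat_abs M \<ge>\<^sub>L
                    U * mat_abs A * mat_adjoint U + V * mat_abs B * mat_adjoint V
                      + W * mat_abs C * mat_adjoint W))"
    using repeated_row_no_three_isometries[OF r0, unfolded dim]
    unfolding Let_def three_equal_rows r_def[symmetric] rows cols by blast
next
  fix d d' :: nat and M A B :: "complex mat"
  assume "M \<in> carrier_mat d d'" "partitioned_into M [A, B]"
  thus "\<exists>U V. isometry d' (dim_col A) U \<and> isometry d' (dim_col B) V \<and>
      complex_of_real (sqrt 2) \<cdot>\<^sub>m mat_abs M \<ge>\<^sub>L
        U * mat_abs A * mat_adjoint U + V * mat_abs B * mat_adjoint V"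
    by (rule loewner_two_blocks)
next
  fix c :: real
  assume c: "c < sqrt 2"
  define r where "r = vec 1 (\<lambda>_. 1 :: complex)"
  have dim: "dim_vec r = 1" by (simp add: r_def)
  have r0: "r \<noteq> 0\<^sub>v (dim_vec r)"
  proof
    assume "r = 0\<^sub>v (dim_vec r)"
    hence "r $ 0 = 0" unfolding dim by simp
    thus False by (simp add: r_def)
  qed
  have part: "partitioned_into (repeated_row 2 r) [mat_of_row r, mat_of_row r]"
    using repeated_row_partition[of r 2] dim by (simp add: numeral_2_eq_2)
  have M: "repeated_row 2 r \<in> carrier_mat 2 1" using repeated_row_carrier[of 2 r] dim by simp
  have cols: "dim_col (mat_of_row r) = 1" by (simp add: mat_of_row_def dim)
  show "\<not> (\<forall>(d::nat) (d'::nat) (M::complex mat) (A::complex mat) (B::complex mat).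
       M \<in> carrier_mat d d' \<longrightarrow> partitioned_into M [A, B] \<longrightarrow>
       (\<exists>U V. isometry d' (dim_col A) U \<and> isometry d' (dim_col B) V \<and>
          complex_of_real c \<cdot>\<^sub>m mat_abs M \<ge>\<^sub>L
            U * mat_abs A * mat_adjoint U + V * mat_abs B * mat_adjoint V))" (is "\<not> ?all")
  proof
    assume ?all
    then obtain U V where "isometry 1 1 U" "isometry 1 1 V"
      "complex_of_real c \<cdot>\<^sub>m mat_abs (repeated_row 2 r) \<ge>\<^sub>L
        U * mat_abs (mat_of_row r) * mat_adjoint U + V * mat_abs (mat_of_row r) * mat_adjoint V"
      using M part unfolding cols[symmetric] by metis
    thus False using repeated_row_no_two_isometries[OF r0 c, unfolded dim] by blast
  qed
qed

end
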